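(* Let $X,Y$ be bounded degree simplicial complexes, where $X$ has dimension $d$ and $Y$ is uniformly $k$-connected for all $1\le k\leq d$. If there is a regular map $X^0\to Y^0$, then for all $q\geq 1$, ${}_s\mathrm{TO}^q_X(r)\lesssim {}_s\mathrm{TO}^q_Y(r)$.
   Context: An abstract simplicial complex is a pair $(S,\mathcal S)$ where $\mathcal S$ is a collection of finite subsets of $S$ containing all singletons and closed under taking subsets; degree is $\max_{s}|\{t\neq s:\{s,t\}\in\mathcal S\}|$, dimension is $\max_{U\in\mathcal S}|U|-1$. A simplicial complex is the topological realisation $\{f:S\to[0,1]:\mathrm{supp}(f)\in\mathcal S,\sum_s f(s)=1\}$ (subspace topology of $[0,1]^S$); it is bounded degree if $S$ is countable and the degree is finite. It carries the metric $d(f,f')=\inf\{\sum_{i=1}^k\|f_{i-1}-f_i\|_2 : f_0=f, f_k=f', \mathrm{supp}(f_{i-1})\cup\mathrm{supp}(f_i)\in\mathcal S\}$. $X^0$ denotes the set of $0$-simplices with the shortest path metric of the $1$-skeleton; $|Z|$ is the number of $0$-simplices; closed simplices are sets of points whose support lies in a fixed element of $\mathcal S$; $Z\le X$ means there is an injection of $0$-simplices of $Z$ into those of $X$ sending simplices to simplices. For finite $Z$ and continuous $f:Z\to\mathbb R^q$, ${}_s\mathrm{Ov}(f)=\max_{z}|\{\sigma\text{ closed simplex of }Z: z\in f(\sigma)\}|$, ${}_s\mathrm{TO}^q(Z)=\min_f {}_s\mathrm{Ov}(f)$, and ${}_s\mathrm{TO}^q_X(r)=\max\{{}_s\mathrm{TO}^q(Z):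 Z\le X, |Z|\le r\}$. A map $X^0\to Y^0$ is regular if it is Lipschitz and preimages of points have uniformly bounded cardinality. A metric space $Y$ is uniformly $k$-connected if for every $s$ there is $S$ such that every continuous $f:S^{k-1}\to Y$ with image of diameter at most $s$ extends to a continuous $g:D^k\to Y$ with image of diameter at most $S$. For $f,g:\mathbb N\to[0,\infty)$, $f\lesssim g$ means there is $C$ with $f(r)\le Cg(Cr)+C$ for all $r$. *)

theory Defs
  imports "HOL-Analysis.Analysis" "HOL-Library.Extended_Nat"
begin

definition is_complex :: "'a set \<Rightarrow> 'a set set \<Rightarrow> bool" where
  "is_complex V S \<longleftrightarrow> (\<forall>U\<in>S. finite U \<and> U \<subseteq> V) \<and> (\<forall>v\<in>V. {v} \<in> S)
      \<and> (\<forall>U\<in>S. \<forall>W. W \<subseteq> U \<longrightarrow> W \<in> S)"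

definition bounded_degree :: "'a set \<Rightarrow> 'a set set \<Rightarrow> bool" where
  "bounded_degree V S \<longleftrightarrow> is_complex V S \<and> countable V \<and>
     (\<exists>D::nat. \<forall>s\<in>V. finite {t. t \<noteq> s \<and> {s,t} \<in> S} \<and> card {t. t \<noteq> s \<and> {s,t} \<in> S} \<le> D)"

definition has_dim :: "'a set set \<Rightarrow> nat \<Rightarrow> bool" where
  "has_dim S d \<longleftrightarrow> (\<forall>U\<in>S. card U \<le> Suc d) \<and> (\<exists>U\<in>S. card U = Suc d)"

definition supp :: "('a \<Rightarrow> real) \<Rightarrow> 'a set" where
  "supp f = {v. f v \<noteq> 0}"

(* topological realisation, as a subset of 'a => real (product topology) *)
definition realis :: "'a set \<Rightarrow> 'a set set \<Rightarrow> ('a \<Rightarrow> real) set" where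
  "realis V S = {f. (\<forall>v. 0 \<le> f v \<and> f v \<le> 1) \<and> supp f \<in> S \<and> sum f (supp f) = 1}"

definition closed_simplex :: "'a set \<Rightarrow> 'a set set \<Rightarrow> 'a set \<Rightarrow> ('a \<Rightarrow> real) set" where
  "closed_simplex V S \<sigma> = {f \<in> realis V S. supp f \<subseteq> \<sigma>}"

definition l2dist :: "('a \<Rightarrow> real) \<Rightarrow> ('a \<Rightarrow> real) \<Rightarrow> real" where
  "l2dist f g = sqrt (\<Sum>v\<in>supp f \<union> supp g. (f v - g v)^2)"

(* the metric d on the realisation (value \<infinity> if no chain exists) *)
definition cdist :: "'a set \<Rightarrow> 'a set set \<Rightarrow> ('a \<Rightarrow> real) \<Rightarrow> ('a \<Rightarrow> real) \<Rightarrow> ereal" where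
  "cdist V S f f' = Inf {ereal (\<Sum>i<k. l2dist (c i) (c (Suc i))) | k c.
      c 0 = f \<and> c k = f' \<and> (\<forall>i\<le>k. c i \<in> realis V S) \<and>
      (\<forall>i<k. supp (c i) \<union> supp (c (Suc i)) \<in> S)}"

(* R^k as functions nat => real vanishing from index k on *)
definition kdist :: "nat \<Rightarrow> (nat \<Rightarrow> real) \<Rightarrow> (nat \<Rightarrow> real) \<Rightarrow> real" where
  "kdist k x y = sqrt (\<Sum>i<k. (x i - y i)^2)"

definition ksphere :: "nat \<Rightarrow> (nat \<Rightarrow> real) set" where  (* S^{k-1} in R^k *)
  "ksphere k = {x. (\<forall>i\<ge>k. x i = 0) \<and> (\<Sum>i<k. (x i)^2) = 1}"

definition kdisc :: "nat \<Rightarrow> (nat \<Rightarrow> real) set" where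
  "kdisc k = {x. (\<forall>i\<ge>k. x i = 0) \<and> (\<Sum>i<k. (x i)^2) \<le> 1}"

definition metric_cont :: "'a set \<Rightarrow> 'a set set \<Rightarrow> nat \<Rightarrow> (nat \<Rightarrow> real) set
      \<Rightarrow> ((nat \<Rightarrow> real) \<Rightarrow> ('a \<Rightarrow> real)) \<Rightarrow> bool" where
  "metric_cont V S k A h \<longleftrightarrow> h ` A \<subseteq> realis V S \<and>
     (\<forall>x\<in>A. \<forall>e>0. \<exists>\<delta>>0. \<forall>y\<in>A. kdist k x y < \<delta> \<longrightarrow> cdist V S (h y) (h x) < ereal e)"

definition diam_le :: "'a set \<Rightarrow> 'a set set \<Rightarrow> ('a \<Rightarrow> real) set \<Rightarrow> real \<Rightarrow> bool" where
  "diam_le V S B s \<longleftrightarrow> (\<forall>x\<in>B. \<forall>y\<in>B. cdist V S x y \<le> ereal s)"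

definition unif_connected :: "'a set \<Rightarrow> 'a set set \<Rightarrow> nat \<Rightarrow> bool" where
  "unif_connected V S k \<longleftrightarrow> (\<forall>s::real. \<exists>T::real. \<forall>f.
      metric_cont V S k (ksphere k) f \<and> diam_le V S (f ` ksphere k) s \<longrightarrow>
      (\<exists>g. metric_cont V S k (kdisc k) g \<and> (\<forall>x\<in>ksphere k. g x = f x)
           \<and> diam_le V S (g ` kdisc k) T))"

definition edge_dist :: "'a set \<Rightarrow> 'a set set \<Rightarrow> 'a \<Rightarrow> 'a \<Rightarrow> enat" where
  "edge_dist V S x y = Inf {enat n | n. \<exists>p. p 0 = x \<and> p n = y \<and> (\<forall>i\<le>n. p i \<in> V)
       \<and> (\<forall>i<n. {p i, p (Suc i)} \<in> S)}"

definition regular_map :: "'a set \<Rightarrow> 'a set set \<Rightarrow> 'b set \<Rightarrow> 'b set set \<Rightarrow> ('a \<Rightarrow> 'b) \<Rightarrow> bool" where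
  "regular_map VX SX VY SY \<phi> \<longleftrightarrow> \<phi> ` VX \<subseteq> VY \<and>
     (\<exists>L::nat. \<forall>x\<in>VX. \<forall>y\<in>VX. edge_dist VY SY (\<phi> x) (\<phi> y) \<le> enat L * edge_dist VX SX x y) \<and>
     (\<exists>N::nat. \<forall>y. finite {x\<in>VX. \<phi> x = y} \<and> card {x\<in>VX. \<phi> x = y} \<le> N)"

definition complex_le :: "'a set \<Rightarrow> 'a set set \<Rightarrow> 'b set \<Rightarrow> 'b set set \<Rightarrow> bool" where
  "complex_le VZ SZ VX SX \<longleftrightarrow> (\<exists>g. inj_on g VZ \<and> g ` VZ \<subseteq> VX \<and> (\<forall>\<sigma>\<in>SZ. g ` \<sigma> \<in> SX))"

definition sOv :: "'a set \<Rightarrow> 'a set set \<Rightarrow> (('a \<Rightarrow> real) \<Rightarrow> real^'q) \<Rightarrow> nat" where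
  "sOv V S f = Sup {card {\<sigma>\<in>S. z \<in> f ` closed_simplex V S \<sigma>} | z. True}"

definition sTO :: "('q::finite) itself \<Rightarrow> 'a set \<Rightarrow> 'a set set \<Rightarrow> nat" where
  "sTO TYPE('q) V S = Inf {sOv V S f | f :: ('a \<Rightarrow> real) \<Rightarrow> real^'q. continuous_on (realis V S) f}"

definition sTO_X :: "('q::finite) itself \<Rightarrow> 'a set \<Rightarrow> 'a set set \<Rightarrow> nat \<Rightarrow> nat" where
  "sTO_X TYPE('q) VX SX r = Sup {sTO TYPE('q) VZ SZ | (VZ :: 'a set) SZ. is_complex VZ SZ \<and> finite VZ
       \<and> complex_le VZ SZ VX SX \<and> card VZ \<le> r}"

definition lesssim :: "(nat \<Rightarrow> nat) \<Rightarrow> (nat \<Rightarrow> nat) \<Rightarrow> bool" where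
  "lesssim f g \<longleftrightarrow> (\<exists>C::nat. \<forall>r. f r \<le> C * g (C * r) + C)"

end

theory Submission
  imports Defs
begin

text \<open>
  Uniform connectedness allows the vertex map to be extended, skeleton by skeleton, to a continuous
  map \<open>\<Phi>\<close> between the realisations that sends simplices to sets of uniformly bounded diameter.
  For a finite \<open>Z \<le> X\<close> the image of \<open>Z\<close> lies in a finite subcomplex \<open>W\<close> of \<open>Y\<close> with at most
  \<open>C |Z|\<close> vertices, and since vertex balls and fibres are uniformly bounded, every simplex of
  \<open>W\<close> is met by the images of at most \<open>C\<close> simplices of \<open>Z\<close>. Composing an optimal map on
  \<open>W\<close> with \<open>\<Phi>\<close> therefore increases the overlap by a factor of at most \<open>C\<close>.
\<close>

section \<open>The path metric\<close>

text \<open>Two topologies meet: uniform connectedness speaks of continuity for the path metric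
  \<open>cdist\<close>, which may be infinite, while overlaps use the product topology. Both give
  the same continuous maps on spheres and discs, so fillings can be glued by arguments in the
  product topology alone. Diameter bounds must become counts of vertices. A truncated graph
  distance, extended affinely, is Lipschitz for \<open>cdist\<close>; hence points at bounded
  distance have supports within some bounded number \<open>N\<close> of edges, and a ball of radius
  \<open>N\<close> has at most \<open>Suc D ^ N\<close> vertices. Simplices are then counted through
  their vertices: those of \<open>Z\<close> having a point whose image has support \<tau> use only
  vertices that are sent into the \<open>N\<close>-ball about one vertex of \<tau>. With fibres of
  size at most \<open>P\<close> there are at most \<open>Q = P * Suc D ^ N\<close> of these, hence
  at most \<open>2 ^ Q\<close> simplices. The map \<Phi> is built once on all of \<open>X\<close>,
  so that no constant depends on \<open>Z\<close>, which enters only through its injection into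
  \<open>X\<close>.\<close>

lemma cdist_le_chain:
  assumes "\<And>i. i \<le> k \<Longrightarrow> c i \<in> realis V S"
    and "\<And>i. i < k \<Longrightarrow> supp (c i) \<union> supp (c (Suc i)) \<in> S"
  shows "cdist V S (c 0) (c k) \<le> ereal (\<Sum>i<k. l2dist (c i) (c (Suc i)))"
  unfolding cdist_def using assms by (intro Inf_lower) blast

lemma cdist_lessE:
  assumes "cdist V S f g < t"
  obtains k c where "c 0 = f" "c k = g" "\<And>i. i \<le> k \<Longrightarrow> c i \<in> realis V S"
    "\<And>i. i < k \<Longrightarrow> supp (c i) \<union> supp (c (Suc i)) \<in> S"
    "ereal (\<Sum>i<k. l2dist (c i) (c (Suc i))) < t"
  using assms unfolding cdist_def Inf_less_iff by blast

lemma cdist_greatest: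
  assumes "\<And>k c. \<lbrakk>c 0 = f; c k = g; \<And>i. i \<le> k \<Longrightarrow> c i \<in> realis V S;
      \<And>i. i < k \<Longrightarrow> supp (c i) \<union> supp (c (Suc i)) \<in> S\<rbrakk>
    \<Longrightarrow> b \<le> ereal (\<Sum>i<k. l2dist (c i) (c (Suc i)))"
  shows "b \<le> cdist V S f g"
  unfolding cdist_def using assms by (intro Inf_greatest) blast

lemma cdist_refl_le: "f \<in> realis V S \<Longrightarrow> cdist V S f f \<le> 0"
  using cdist_le_chain[of 0 "\<lambda>_. f"] by (simp add: zero_ereal_def)

lemma l2dist_nonneg: "0 \<le> l2dist f g"
  by (simp add: l2dist_def sum_nonneg)

lemma cdist_nonneg: "0 \<le> cdist V S f g"
  by (rule cdist_greatest) (simp add: l2dist_nonneg sum_nonneg)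

lemma l2dist_commute: "l2dist f g = l2dist g f"
  by (simp add: l2dist_def Un_commute power2_commute)

lemma cdist_le_l2dist:
  assumes "f \<in> realis V S" "g \<in> realis V S" "supp f \<union> supp g \<in> S"
  shows "cdist V S f g \<le> ereal (l2dist f g)"
  using cdist_le_chain[of 1 "\<lambda>i. if i = 0 then f else g" V S] assms by auto

text \<open>Any chain from \<open>f\<close> to \<open>g\<close> can be prolonged by the single link
  to \<open>h\<close>. Moving the finite \<open>l2dist g h\<close> to the left turns the claim into
  a lower bound for an infimum.\<close>

lemma cdist_append:
  assumes "h \<in> realis V S" "supp g \<union> supp h \<in> S"
  shows "cdist V S f h \<le> cdist V S f g + ereal (l2dist g h)"
proof -
  have "cdist V S f h - ereal (l2dist g h) \<le> cdist V S f g"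
  proof (rule cdist_greatest)
    fix k c
    assume c: "c 0 = f" "c k = g" "\<And>i. i \<le> k \<Longrightarrow> c i \<in> realis V S"
      "\<And>i. i < k \<Longrightarrow> supp (c i) \<union> supp (c (Suc i)) \<in> S"
    have "cdist V S f h \<le> ereal ((\<Sum>i<k. l2dist (c i) (c (Suc i))) + l2dist g h)"
    proof -
      define c' where "c' = (\<lambda>i. if i \<le> k then c i else h)"
      have "cdist V S (c' 0) (c' (Suc k)) \<le> ereal (\<Sum>i<Suc k. l2dist (c' i) (c' (Suc i)))"
        using c assms by (intro cdist_le_chain) (auto simp: c'_def Suc_le_eq not_less le_Suc_eq less_Suc_eq)
      then show ?thesis using c by (simp add: c'_def)
    qed
    then show "cdist V S f h - ereal (l2dist g h) \<le> ereal (\<Sum>i<k. l2dist (c i) (c (Suc i)))"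
      by (simp add: ereal_minus_le)
  qed
  then show ?thesis
    by (simp add: ereal_minus_le)
qed

text \<open>Chains are not concatenated: \<open>*\<close> follows a chain out of \<open>g\<close>
  link by link with \<open>cdist_append\<close>, after which the infimum is taken over this second
  chain only.\<close>

lemma cdist_triangle: "cdist V S f h \<le> cdist V S f g + cdist V S g h"
proof -
  have *: "cdist V S f (c k) \<le> cdist V S f (c 0) + ereal (\<Sum>i<k. l2dist (c i) (c (Suc i)))"
    if "\<And>i. i \<le> k \<Longrightarrow> c i \<in> realis V S" "\<And>i. i < k \<Longrightarrow> supp (c i) \<union> supp (c (Suc i)) \<in> S"
    for k c
    using that
  proof (induction k)
    case (Suc k)
    have "cdist V S f (c (Suc k)) \<le> cdist V S f (c k) + ereal (l2dist (c k) (c (Suc k)))"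
      using Suc.prems by (intro cdist_append) auto
    also have "\<dots> \<le> (cdist V S f (c 0) + ereal (\<Sum>i<k. l2dist (c i) (c (Suc i))))
        + ereal (l2dist (c k) (c (Suc k)))"
      using Suc by (intro add_right_mono) auto
    finally show ?case by (simp add: add.assoc)
  qed (simp add: zero_ereal_def[symmetric])
  show ?thesis
  \<comment> \<open>Only a finite first summand can be moved to the other side; an infinite one
    makes the bound trivial.\<close>
  proof (cases "cdist V S f g = \<infinity>")
    case False
    then obtain a where a: "cdist V S f g = ereal a"
      using cdist_nonneg[of V S f g] by (cases "cdist V S f g") auto
    have "cdist V S f h - ereal a \<le> cdist V S g h"
    proof (rule cdist_greatest)
      fix k c
      assume "c 0 = g" "c k = h" "\<And>i. i \<le> k \<Longrightarrow> c i \<in> realis V S"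
        "\<And>i. i < k \<Longrightarrow> supp (c i) \<union> supp (c (Suc i)) \<in> S"
      then show "cdist V S f h - ereal a \<le> ereal (\<Sum>i<k. l2dist (c i) (c (Suc i)))"
        using *[of k c] a by (simp add: ereal_minus_le add.commute)
    qed
    then show ?thesis by (simp add: a ereal_minus_le add.commute)
  qed simp
qed

lemma cdist_commute_le: "cdist V S g f \<le> cdist V S f g"
proof (rule cdist_greatest)
  fix k c
  assume "c 0 = f" "c k = g" "\<And>i. i \<le> k \<Longrightarrow> c i \<in> realis V S"
    "\<And>i. i < k \<Longrightarrow> supp (c i) \<union> supp (c (Suc i)) \<in> S"
  then show "cdist V S g f \<le> ereal (\<Sum>i<k. l2dist (c i) (c (Suc i)))"
  proof (induction k arbitrary: g)
    case 0
    then show ?case by (auto intro: cdist_refl_le simp: zero_ereal_def[symmetric])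
  next
    case (Suc k)
    have "cdist V S (c (Suc k)) (c k) \<le> ereal (l2dist (c (Suc k)) (c k))"
      using Suc.prems by (intro cdist_le_l2dist) (auto simp: Un_commute)
    moreover have "cdist V S (c k) f \<le> ereal (\<Sum>i<k. l2dist (c i) (c (Suc i)))"
      using Suc by auto
    ultimately have "cdist V S (c (Suc k)) f
        \<le> ereal (l2dist (c (Suc k)) (c k)) + ereal (\<Sum>i<k. l2dist (c i) (c (Suc i)))"
      using cdist_triangle add_mono order_trans by blast
    then show ?case using Suc.prems by (simp add: l2dist_commute add.commute)
  qed
qed

lemma cdist_commute: "cdist V S f g = cdist V S g f"
  by (simp add: antisym cdist_commute_le)

lemma realis_finite_supp:
  assumes "is_complex V S" "f \<in> realis V S"
  shows "finite (supp f)"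
  using assms by (auto simp: is_complex_def realis_def)

lemma abs_diff_le_l2dist:
  assumes "finite (supp f)" "finite (supp g)"
  shows "\<bar>f v - g v\<bar> \<le> l2dist f g"
proof (cases "v \<in> supp f \<union> supp g")
  case True
  have "(f v - g v)^2 \<le> (\<Sum>v\<in>supp f \<union> supp g. (f v - g v)^2)"
    using assms True by (intro member_le_sum) auto
  then show ?thesis
    by (simp add: l2dist_def real_le_rsqrt)
qed (auto simp: supp_def l2dist_nonneg)

text \<open>A Lipschitz bound on single links telescopes along a chain. Strictness of the distance
  hypothesis supplies an actual chain of length below \<open>t\<close>, as the infimum need not be
  attained.\<close>

lemma lipschitz_le_cdist:
  assumes "\<And>x y. \<lbrakk>x \<in> realis V S; y \<in> realis V S; supp x \<union> supp y \<in> S\<rbrakk>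
      \<Longrightarrow> \<bar>H x - H y\<bar> \<le> K * l2dist x y"
    and "K \<ge> 0" "cdist V S f g < ereal t"
  shows "\<bar>H f - H g\<bar> \<le> K * t"
proof -
  obtain k c where c: "c 0 = f" "c k = g" "\<And>i. i \<le> k \<Longrightarrow> c i \<in> realis V S"
    "\<And>i. i < k \<Longrightarrow> supp (c i) \<union> supp (c (Suc i)) \<in> S"
    "ereal (\<Sum>i<k. l2dist (c i) (c (Suc i))) < t"
    using assms(3) by (rule cdist_lessE) blast
  have "\<bar>H (c 0) - H (c k)\<bar> \<le> (\<Sum>i<k. \<bar>H (c i) - H (c (Suc i))\<bar>)"
    by (induction k) auto
  also have "\<dots> \<le> (\<Sum>i<k. K * l2dist (c i) (c (Suc i)))"
    using c by (intro sum_mono assms(1)) auto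
  also have "\<dots> \<le> K * t"
    using c(5) \<open>K \<ge> 0\<close> by (simp add: sum_distrib_left[symmetric] mult_left_mono)
  finally show ?thesis using c by simp
qed

text \<open>Coordinates are 1-Lipschitz along links; this is why convergence for
  \<open>cdist\<close> implies convergence in the product topology.\<close>

lemma abs_diff_le_cdist:
  fixes f g :: "'a \<Rightarrow> real"
  assumes "is_complex V S" "cdist V S f g < ereal t"
  shows "\<bar>f v - g v\<bar> \<le> t"
proof -
  have *: "\<bar>x v - y v\<bar> \<le> 1 * l2dist x y"
    if "x \<in> realis V S" "y \<in> realis V S" "supp x \<union> supp y \<in> S" for x y :: "'a \<Rightarrow> real"
    using abs_diff_le_l2dist[of x y v] realis_finite_supp[OF assms(1)] that by simp
  have "\<bar>f v - g v\<bar> \<le> 1 * t"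
    by (rule lipschitz_le_cdist[of V S "\<lambda>x. x v" 1 f g t]) (use * assms(2) in auto)
  then show ?thesis by simp
qed

section \<open>The metric topology is the product topology\<close>

lemma realis_sum_superset:
  assumes "f \<in> realis V S" "finite A" "supp f \<subseteq> A"
  shows "sum f A = 1"
  using assms by (subst sum.mono_neutral_right[of A "supp f"]) (auto simp: realis_def supp_def)

lemma realis_nonneg: "f \<in> realis V S \<Longrightarrow> 0 \<le> f v"
  by (simp add: realis_def)

lemma realis_supp_nonempty: "f \<in> realis V S \<Longrightarrow> supp f \<noteq> {}"
  by (auto simp: realis_def)

text \<open>Since both points have total mass 1, the mass of \<open>y\<close> off the support of \<open>x\<close> is
  what \<open>y\<close> lacks on it.\<close>

lemma l2dist_le_sum_supp:
  assumes "is_complex V S" "x \<in> realis V S" "y \<in> realis V S" "supp x \<subseteq> supp y"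
  shows "l2dist x y \<le> 2 * (\<Sum>v\<in>supp x. \<bar>x v - y v\<bar>)"
proof -
  have fin: "finite (supp y)" "finite (supp x)"
    using assms realis_finite_supp by blast+
  have "l2dist x y \<le> (\<Sum>v\<in>supp y. \<bar>x v - y v\<bar>)"
    using L2_set_le_sum_abs[of "\<lambda>v. x v - y v" "supp y"] assms(4)
    by (simp add: l2dist_def L2_set_def Un_absorb1)
  also have "\<dots> = (\<Sum>v\<in>supp x. \<bar>x v - y v\<bar>) + (\<Sum>v\<in>supp y - supp x. \<bar>x v - y v\<bar>)"
    using sum.subset_diff[OF assms(4) fin(1)] by (simp add: add.commute)
  also have "(\<Sum>v\<in>supp y - supp x. \<bar>x v - y v\<bar>) = (\<Sum>v\<in>supp y - supp x. y v)"
    using assms by (intro sum.cong) (auto simp: supp_def realis_nonneg)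
  also have "\<dots> = sum y (supp y) - sum y (supp x)"
    using fin assms(4) by (simp add: sum_diff)
  also have "\<dots> = (\<Sum>v\<in>supp x. x v - y v)"
    using assms by (simp add: sum_subtractf realis_def)
  also have "\<dots> \<le> (\<Sum>v\<in>supp x. \<bar>x v - y v\<bar>)"
    by (intro sum_mono) auto
  finally show ?thesis by simp
qed

text \<open>The converse comparison. Pointwise convergence controls only finitely many coordinates
  uniformly, but \<open>supp x\<close> is finite: eventually \<open>y n\<close> is positive on all
  of it, so that one link joins \<open>y n\<close> to \<open>x\<close>, and its length is bounded
  through the coordinates in \<open>supp x\<close> alone.\<close>

lemma cdist_tendsto_0:
  assumes S: "is_complex V S" and x: "x \<in> realis V S"
    and y: "eventually (\<lambda>n. y n \<in> realis V S) F"
    and lim: "\<And>v. ((\<lambda>n. y n v) \<longlongrightarrow> x v) F" and e: "e > 0"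
  shows "eventually (\<lambda>n. cdist V S (y n) x < ereal e) F"
proof -
  have fin: "finite (supp x)" using S x by (rule realis_finite_supp)
  have pos: "eventually (\<lambda>n. \<forall>v\<in>supp x. 0 < y n v) F"
  proof (rule eventually_ball_finite[OF fin], rule ballI)
    fix v assume "v \<in> supp x"
    then have "x v > 0"
      using realis_nonneg[OF x, of v] by (auto simp: supp_def less_le)
    then show "eventually (\<lambda>n. 0 < y n v) F"
      using order_tendstoD(1)[OF lim] by blast
  qed
  have "((\<lambda>n. 2 * (\<Sum>v\<in>supp x. \<bar>x v - y n v\<bar>)) \<longlongrightarrow> 2 * (\<Sum>v\<in>supp x. \<bar>x v - x v\<bar>)) F"
    by (intro tendsto_intros lim)
  then have "eventually (\<lambda>n. 2 * (\<Sum>v\<in>supp x. \<bar>x v - y n v\<bar>) < e) F"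
    using e by (auto intro: order_tendstoD(2))
  with pos y show ?thesis
  proof eventually_elim
    case (elim n)
    have sub: "supp x \<subseteq> supp (y n)" using elim by (auto simp: supp_def)
    then have "supp (y n) \<union> supp x \<in> S"
      using elim(2) by (simp add: Un_absorb2 realis_def)
    then have "cdist V S (y n) x \<le> ereal (l2dist x (y n))"
      using cdist_le_l2dist[of "y n" V S x] elim x by (simp add: l2dist_commute)
    also have "\<dots> \<le> ereal (2 * (\<Sum>v\<in>supp x. \<bar>x v - y n v\<bar>))"
      using l2dist_le_sum_supp[OF S x elim(2) sub] by simp
    also have "\<dots> < e" using elim by simp
    finally show ?case .
  qed
qed

section \<open>Continuity for \<open>kdist\<close> and \<open>cdist\<close> versus continuity in the
  product topologies\<close>

lemma tendsto_funI:
  fixes y :: "'n \<Rightarrow> 'i \<Rightarrow> 'c::topological_space"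
  assumes "\<And>i. ((\<lambda>n. y n i) \<longlongrightarrow> x i) F"
  shows "(y \<longlongrightarrow> x) F"
proof -
  have "limitin (product_topology (\<lambda>i. euclidean) UNIV) y x F"
    using assms by (simp add: limitin_componentwise)
  then show ?thesis by (simp add: euclidean_product_topology)
qed

lemma continuous_on_coordinate:
  "continuous_on A (\<lambda>x :: 'i \<Rightarrow> 'c::topological_space. x i)"
  by (rule continuous_on_subset[OF continuous_on_product_coordinates]) simp

lemma kdist_self [simp]: "kdist k x x = 0"
  by (simp add: kdist_def)

lemma continuous_on_kdist: "continuous_on A (kdist k x)"
  unfolding kdist_def
  by (intro continuous_intros continuous_on_coordinate)

lemma metric_cont_imp_continuous_on:
  assumes S: "is_complex V S" and h: "metric_cont V S k A h"
  shows "continuous_on A h"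
proof (rule continuous_on_coordinatewise_then_product)
  fix v
  show "continuous_on A (\<lambda>x. h x v)"
    unfolding continuous_on_def tendsto_iff
  proof (intro ballI allI impI)
    fix x and e :: real assume x: "x \<in> A" and e: "e > 0"
    \<comment> \<open>Half of \<open>e\<close>, because \<open>abs_diff_le_cdist\<close> returns a
      non-strict bound.\<close>
    obtain \<delta> where \<delta>: "\<delta> > 0" "\<And>y. \<lbrakk>y \<in> A; kdist k x y < \<delta>\<rbrakk> \<Longrightarrow> cdist V S (h y) (h x) < ereal (e/2)"
    proof -
      have "\<exists>\<delta>>0. \<forall>y\<in>A. kdist k x y < \<delta> \<longrightarrow> cdist V S (h y) (h x) < ereal (e/2)"
        using h x half_gt_zero[OF e] unfolding metric_cont_def by blast
      then show ?thesis using that by blast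
    qed
    have "(kdist k x \<longlongrightarrow> kdist k x x) (at x within A)"
      using continuous_on_kdist[of A k x] x unfolding continuous_on_def by blast
    then have "eventually (\<lambda>y. kdist k x y < \<delta>) (at x within A)"
      using \<delta>(1) kdist_self by (auto intro: order_tendstoD(2))
    moreover have "eventually (\<lambda>y. y \<in> A) (at x within A)"
      by (simp add: eventually_at_filter)
    ultimately show "\<forall>\<^sub>F y in at x within A. dist (h y v) (h x v) < e"
    proof eventually_elim
      case (elim y)
      then show ?case
        using abs_diff_le_cdist[OF S \<delta>(2)[of y], of v] e by (simp add: dist_real_def)
    qed
  qed
qed

text \<open>If the condition fails at \<open>x\<close>, points \<open>y n\<close> of
  \<open>A\<close> within \<open>1 / Suc n\<close> of \<open>x\<close> violate it. As elements of
  \<open>A\<close> vanish from index \<open>k\<close> on, \<open>kdist\<close> controls every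
  coordinate, so \<open>y\<close> converges to \<open>x\<close> in the product topology and
  \<open>cdist_tendsto_0\<close> gives the contradiction.\<close>

lemma continuous_on_imp_metric_cont:
  assumes S: "is_complex V S" and h: "continuous_on A h" "h ` A \<subseteq> realis V S"
    and A: "\<And>x i. \<lbrakk>x \<in> A; i \<ge> k\<rbrakk> \<Longrightarrow> x i = 0"
  shows "metric_cont V S k A h"
  unfolding metric_cont_def
proof (intro conjI ballI allI impI, rule h(2), rule ccontr)
  fix x and e :: real
  assume x: "x \<in> A" and e: "e > 0"
    and "\<not> (\<exists>\<delta>>0. \<forall>y\<in>A. kdist k x y < \<delta> \<longrightarrow> cdist V S (h y) (h x) < ereal e)"
  then have "\<exists>y\<in>A. kdist k x y < 1 / real (Suc n) \<and> \<not> cdist V S (h y) (h x) < ereal e" for n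
    by (metis zero_less_divide_1_iff of_nat_0_less_iff zero_less_Suc)
  then obtain y where y: "\<And>n. y n \<in> A" "\<And>n. kdist k x (y n) < 1 / real (Suc n)"
    "\<And>n. \<not> cdist V S (h (y n)) (h x) < ereal e"
    by metis
  have "y \<longlonglongrightarrow> x"
  proof (rule tendsto_funI)
    fix i
    show "(\<lambda>n. y n i) \<longlonglongrightarrow> x i"
    proof (cases "i < k")
      case True
      have "norm (y n i - x i) \<le> 1 / real (Suc n)" for n
      proof -
        have "(x i - y n i)^2 \<le> (\<Sum>i<k. (x i - y n i)^2)"
          using True by (intro member_le_sum) auto
        then have "\<bar>x i - y n i\<bar> \<le> kdist k x (y n)"
          by (simp add: kdist_def real_le_rsqrt)
        then show ?thesis using y(2)[of n] by (simp add: abs_minus_commute)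
      qed
      moreover have "(\<lambda>n. 1 / real (Suc n)) \<longlonglongrightarrow> 0"
        using LIMSEQ_inverse_real_of_nat by (simp add: inverse_eq_divide)
      ultimately have "(\<lambda>n. y n i - x i) \<longlonglongrightarrow> 0"
        by (intro Lim_null_comparison[of "\<lambda>n. y n i - x i"]) (auto intro: always_eventually)
      then show ?thesis by (simp add: LIM_zero_iff)
    next
      case False
      then have "y n i = 0" "x i = 0" for n using A x y(1) by auto
      then show ?thesis by simp
    qed
  qed
  then have "(\<lambda>n. h (y n)) \<longlonglongrightarrow> h x"
    using y(1) by (intro continuous_on_tendsto_compose[OF h(1) _ x]) auto
  then have "(\<lambda>n. h (y n) v) \<longlonglongrightarrow> h x v" for v
    using continuous_on_tendsto_compose[OF continuous_on_product_coordinates, of "\<lambda>n. h (y n)"]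
    by simp
  then have "eventually (\<lambda>n. cdist V S (h (y n)) (h x) < ereal e) sequentially"
    using h(2) x y(1) e by (intro cdist_tendsto_0[OF S] always_eventually) auto
  then show False using y(3) by simp
qed

section \<open>Closed simplices and discs\<close>

text \<open>With the sum taken over the fixed set \<open>\<sigma>\<close> instead of the varying
  support, each condition is closed and involves finitely many coordinates.\<close>

lemma closed_simplex_eq:
  assumes "is_complex V S" "\<sigma> \<in> S"
  shows "closed_simplex V S \<sigma> =
    {f. (\<forall>v. 0 \<le> f v \<and> f v \<le> 1) \<and> (\<forall>v. v \<notin> \<sigma> \<longrightarrow> f v = 0) \<and> sum f \<sigma> = 1}" (is "_ = ?R")
proof -
  have fin: "finite \<sigma>" using assms by (auto simp: is_complex_def)
  have sum_eq: "sum f \<sigma> = sum f (supp f)" if "supp f \<subseteq> \<sigma>" for f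
    using that fin by (intro sum.mono_neutral_right) (auto simp: supp_def)
  have sub: "supp f \<subseteq> \<sigma> \<longleftrightarrow> (\<forall>v. v \<notin> \<sigma> \<longrightarrow> f v = 0)" for f
    by (auto simp: supp_def)
  have "supp f \<in> S" if "supp f \<subseteq> \<sigma>" for f
    using that assms unfolding is_complex_def by blast
  with sum_eq show ?thesis
    unfolding closed_simplex_def realis_def sub[symmetric] by auto
qed

lemma closed_simplexD:
  assumes "is_complex V S" "\<sigma> \<in> S" "f \<in> closed_simplex V S \<sigma>"
  shows "0 \<le> f v" "f v \<le> 1" "v \<notin> \<sigma> \<Longrightarrow> f v = 0" "sum f \<sigma> = 1"
  using assms(3) unfolding closed_simplex_eq[OF assms(1,2)] by simp_all

lemma closed_closed_simplex:
  assumes "is_complex V S" "\<sigma> \<in> S"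
  shows "closed (closed_simplex V S \<sigma>)"
proof -
  have c: "continuous_on UNIV (\<lambda>f :: 'a \<Rightarrow> real. f v)" for v by simp
  have "closed {f :: 'a \<Rightarrow> real. 0 \<le> f v}" "closed {f :: 'a \<Rightarrow> real. f v \<le> 1}"
    "closed {f :: 'a \<Rightarrow> real. v \<notin> \<sigma> \<longrightarrow> f v = 0}" for v
    using c[of v] by (auto intro!: closed_Collect_conj closed_Collect_imp closed_Collect_le closed_Collect_eq)
  moreover have "closed {f :: 'a \<Rightarrow> real. sum f \<sigma> = 1}"
    by (intro closed_Collect_eq continuous_on_sum c continuous_on_const)
  ultimately show ?thesis
    unfolding closed_simplex_eq[OF assms] by (intro closed_Collect_conj closed_Collect_all)
qed

lemma simplex_subset: "is_complex V S \<Longrightarrow> \<sigma> \<in> S \<Longrightarrow> \<tau> \<subseteq> \<sigma> \<Longrightarrow> \<tau> \<in> S"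
  by (simp add: is_complex_def)

lemma simplex_finite: "is_complex V S \<Longrightarrow> \<sigma> \<in> S \<Longrightarrow> finite \<sigma>"
  by (simp add: is_complex_def)

lemma realis_eq_Union: "realis V S = (\<Union>\<sigma>\<in>S. closed_simplex V S \<sigma>)"
proof (intro equalityI subsetI)
  fix f assume f: "f \<in> realis V S"
  then have "supp f \<in> S" by (simp add: realis_def)
  with f show "f \<in> (\<Union>\<sigma>\<in>S. closed_simplex V S \<sigma>)" by (auto simp: closed_simplex_def)
qed (auto simp: closed_simplex_def)

section \<open>Filling the boundary of a simplex\<close>

lemma continuous_on_Min_image:
  fixes f :: "'i \<Rightarrow> 'c::topological_space \<Rightarrow> real"
  assumes "finite I" "I \<noteq> {}" "\<And>i. i \<in> I \<Longrightarrow> continuous_on A (f i)"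
  shows "continuous_on A (\<lambda>x. Min ((\<lambda>i. f i x) ` I))"
  using assms
proof (induction I rule: finite_ne_induct)
  case (insert i I)
  then have "continuous_on A (\<lambda>x. min (f i x) (Min ((\<lambda>i. f i x) ` I)))"
    by (intro continuous_on_min) auto
  then show ?case using insert by simp
qed simp

text \<open>Subtracting the last barycentric coordinate identifies the simplex with a convex body in
  \<open>\<real>^k\<close> around the image \<open>0\<close> of the barycentre, and the smallest barycentric coordinate vanishes
  exactly on the boundary. The map \<open>p\<close> inverts \<open>q\<close> only on the boundary, which is all that is
  needed to fill boundaries.\<close>

lemma simplex_disc_maps:
  assumes S: "is_complex V S" "\<sigma> \<in> S" and card: "card \<sigma> = Suc k"
  obtains p q where
    "continuous_on (closed_simplex V S \<sigma>) q" "q ` closed_simplex V S \<sigma> \<subseteq> kdisc k"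
    "continuous_on (ksphere k) p" "p ` ksphere k \<subseteq> {x \<in> closed_simplex V S \<sigma>. supp x \<noteq> \<sigma>}"
    "\<And>x. \<lbrakk>x \<in> closed_simplex V S \<sigma>; supp x \<noteq> \<sigma>\<rbrakk> \<Longrightarrow> q x \<in> ksphere k \<and> p (q x) = x"
proof -
  have fin: "finite \<sigma>" and ne: "\<sigma> \<noteq> {}" using S card simplex_finite by fastforce+
  obtain e where e0: "bij_betw e {0..<card \<sigma>} \<sigma>"
    using ex_bij_betw_nat_finite[OF fin] by blast
  have "{0..<card \<sigma>} = {..k}" using card by auto
  with e0 have e: "bij_betw e {..k} \<sigma>" by simp
  note D = closed_simplexD[OF S]
  define u where "u = (\<lambda>t i. if i < k then t (e i) - t (e k) else (0::real))"
  define N where "N = (\<lambda>t. sqrt (\<Sum>i<k. (u t i)^2))"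
  \<comment> \<open>The least barycentric coordinate \<open>m t\<close> keeps the denominator of
    \<open>q\<close> positive at the barycentre, where \<open>N t\<close> is 0, and vanishes on the
    boundary, so that \<open>q t\<close> has norm 1 there.\<close>
  define m where "m = (\<lambda>t. Min ((\<lambda>v. t v :: real) ` \<sigma>))"
  define q where "q = (\<lambda>t i. u t i / (N t + m t))"
  \<comment> \<open>The range includes the index \<open>k\<close>, at which points of the sphere are
    0. Subtracting the minimum creates a vanishing coordinate, and dividing by the sum
    \<open>l x\<close> gives barycentric coordinates of a boundary point.\<close>
  define \<mu> where "\<mu> = (\<lambda>x. Min ((\<lambda>i. x i :: real) ` {..k}))"
  define l where "l = (\<lambda>x. \<Sum>i\<le>k. x i - \<mu> x)"
  define p where "p = (\<lambda>x v. if v \<in> \<sigma> then (x (inv_into {..k} e v) - \<mu> x) / l x else 0)"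
  have N0: "N t \<ge> 0" for t by (simp add: N_def sum_nonneg)
  have NN: "(\<Sum>i<k. (u t i)^2) = (N t)^2" for t by (simp add: N_def sum_nonneg)
  have m0: "m t \<ge> 0" if "t \<in> closed_simplex V S \<sigma>" for t
    using D(1)[OF that] fin ne by (simp add: m_def)
  have pos: "N t + m t > 0" if t: "t \<in> closed_simplex V S \<sigma>" for t
  proof (rule ccontr)
    assume "\<not> N t + m t > 0"
    then have "N t = 0" "m t = 0" using N0[of t] m0[OF t] by linarith+
    then have "\<forall>i<k. u t i = 0"
      using NN[of t] by (simp add: sum_nonneg_eq_0_iff)
    then have "t (e i) = t (e k)" if "i \<le> k" for i
      using that by (cases "i = k") (auto simp: u_def split: if_splits)
    then have const: "t v = t (e k)" if "v \<in> \<sigma>" for v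
      using e that by (metis atMost_iff bij_betw_iff_bijections)
    have "m t \<in> t ` \<sigma>" using fin ne by (simp add: m_def)
    then have "t v = 0" if "v \<in> \<sigma>" for v using const that \<open>m t = 0\<close> by auto
    then show False using D(4)[OF t] by simp
  qed
  have mB: "m t = 0" if "t \<in> closed_simplex V S \<sigma>" "supp t \<noteq> \<sigma>" for t
  proof -
    have "\<exists>v\<in>\<sigma>. t v = 0" using that by (auto simp: supp_def closed_simplex_def)
    then have "m t \<le> 0" using fin by (force simp: m_def intro: Min_le)
    then show ?thesis using m0[OF that(1)] by simp
  qed
  have sum_q: "(\<Sum>i<k. (q t i)^2) = (N t)^2 / (N t + m t)^2" for t
    by (simp add: q_def power_divide sum_divide_distrib[symmetric] NN)
  have lpos: "l x > 0" if x: "x \<in> ksphere k" for x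
  proof (rule ccontr)
    assume neg: "\<not> l x > 0"
    have nn: "x i - \<mu> x \<ge> 0" if "i \<le> k" for i
      using that by (auto simp: \<mu>_def intro!: Min_le)
    then have "l x \<ge> 0" unfolding l_def by (intro sum_nonneg) auto
    then have "l x = 0" using neg by simp
    then have "\<forall>i\<le>k. x i = \<mu> x"
      using nn sum_nonneg_eq_0_iff[of "{..k}" "\<lambda>i. x i - \<mu> x"] by (simp add: l_def)
    moreover have "x k = 0" using x by (simp add: ksphere_def)
    ultimately have "\<forall>i<k. x i = 0" by (metis le_refl less_imp_le)
    then have "(\<Sum>i<k. (x i)^2) = 0" by simp
    then show False using x by (simp add: ksphere_def)
  qed
  have inv: "inv_into {..k} e v \<le> k" "e (inv_into {..k} e v) = v" if "v \<in> \<sigma>" for v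
    using e that by (auto simp: bij_betw_def f_inv_into_f dest: inv_into_into)
  have inv2: "inv_into {..k} e (e i) = i" "e i \<in> \<sigma>" if "i \<le> k" for i
    using e that by (auto simp: bij_betw_def)
  show thesis
  proof (rule that)
    show "continuous_on (closed_simplex V S \<sigma>) q"
    proof (rule continuous_on_coordinatewise_then_product)
      fix i
      have u: "continuous_on A (\<lambda>t. u t i)" for A i
        unfolding u_def by (cases "i < k") (auto intro!: continuous_intros continuous_on_coordinate)
      have m: "continuous_on A m" for A
        unfolding m_def using fin ne by (intro continuous_on_Min_image continuous_on_coordinate)
      show "continuous_on (closed_simplex V S \<sigma>) (\<lambda>t. q t i)"
        unfolding q_def N_def
        by (intro continuous_intros u m) (use pos in \<open>force simp: N_def\<close>)
    qed
    show "q ` closed_simplex V S \<sigma> \<subseteq> kdisc k"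
    proof (rule image_subsetI)
      fix t assume t: "t \<in> closed_simplex V S \<sigma>"
      have "(N t)^2 \<le> (N t + m t)^2" using N0 m0[OF t] by (simp add: power_mono)
      then have "(\<Sum>i<k. (q t i)^2) \<le> 1"
        using pos[OF t] by (simp add: sum_q)
      then show "q t \<in> kdisc k" by (simp add: kdisc_def q_def u_def)
    qed
    show "continuous_on (ksphere k) p"
    proof (rule continuous_on_coordinatewise_then_product)
      fix v
      have m: "continuous_on A \<mu>" for A
        unfolding \<mu>_def by (intro continuous_on_Min_image continuous_on_coordinate) auto
      have "continuous_on (ksphere k) l"
        unfolding l_def by (intro continuous_intros m continuous_on_coordinate)
      then have "continuous_on (ksphere k) (\<lambda>x. (x (inv_into {..k} e v) - \<mu> x) / l x)"
        using lpos by (intro continuous_intros m continuous_on_coordinate) force+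
      then show "continuous_on (ksphere k) (\<lambda>x. p x v)"
        unfolding p_def by (cases "v \<in> \<sigma>") auto
    qed
    show "p ` ksphere k \<subseteq> {x \<in> closed_simplex V S \<sigma>. supp x \<noteq> \<sigma>}"
    proof (rule image_subsetI)
      fix x assume x: "x \<in> ksphere k"
      have pe: "p x (e i) = (x i - \<mu> x) / l x" if "i \<le> k" for i
        using inv2 that by (simp add: p_def)
      have nn: "p x v \<ge> 0" for v
        using lpos[OF x] inv(1)[of v] by (auto simp: p_def \<mu>_def intro!: divide_nonneg_pos Min_le)
      have "sum (p x) \<sigma> = (\<Sum>i\<le>k. p x (e i))"
        using sum.reindex_bij_betw[OF e, of "p x"] by simp
      also have "\<dots> = (\<Sum>i\<le>k. x i - \<mu> x) / l x"
        by (simp add: pe sum_divide_distrib)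
      also have "\<dots> = 1" using lpos[OF x] by (simp add: l_def)
      finally have s1: "sum (p x) \<sigma> = 1" .
      have "p x v \<le> 1" for v
      proof (cases "v \<in> \<sigma>")
        case True
        then have "p x v \<le> sum (p x) \<sigma>" using fin nn by (intro member_le_sum) auto
        then show ?thesis using s1 by simp
      qed (simp add: p_def)
      with nn s1 have "p x \<in> closed_simplex V S \<sigma>"
        unfolding closed_simplex_eq[OF S] by (auto simp: p_def)
      moreover have "\<mu> x \<in> x ` {..k}" unfolding \<mu>_def by (rule Min_in) auto
      then obtain i where i: "i \<le> k" "\<mu> x = x i" by auto
      then have "p x (e i) = 0" by (simp add: pe)
      then have "supp (p x) \<noteq> \<sigma>" using inv2(2)[OF i(1)] by (auto simp: supp_def)
      ultimately show "p x \<in> {x \<in> closed_simplex V S \<sigma>. supp x \<noteq> \<sigma>}" by simp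
    qed
    fix t assume t: "t \<in> closed_simplex V S \<sigma>" "supp t \<noteq> \<sigma>"
    have m: "m t = 0" using mB t by simp
    have Npos: "N t > 0" using pos[OF t(1)] m by simp
    have "(\<Sum>i<k. (q t i)^2) = 1" using Npos by (simp add: sum_q m)
    then have "q t \<in> ksphere k" by (simp add: ksphere_def q_def u_def)
    have qi: "q t i = (t (e i) - t (e k)) / N t" if "i \<le> k" for i
      using that by (cases "i = k") (auto simp: q_def u_def m)
    have "m t \<in> t ` \<sigma>" unfolding m_def using fin ne by (intro Min_in) auto
    then have "0 \<in> t ` \<sigma>" by (simp only: m)
    then obtain j where j: "j \<le> k" "t (e j) = 0"
      using e by (auto simp: bij_betw_def)
    \<comment> \<open>The minimum is reached at the index \<open>j\<close> of a vanishing
      barycentric coordinate and is the shift introduced by \<open>q\<close>, scaled by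
      \<open>N t\<close>. Subtracting it leaves the coordinates of \<open>t\<close> over
      \<open>N t\<close>, which division by \<open>l (q t)\<close> rescales to
      \<open>t\<close>.\<close>
    have \<mu>: "\<mu> (q t) = - t (e k) / N t"
      unfolding \<mu>_def
    proof (rule Min_eqI)
      show "- t (e k) / N t \<in> q t ` {..k}" using j qi[of j] by force
      show "- t (e k) / N t \<le> y" if "y \<in> q t ` {..k}" for y
        using that qi D(1)[OF t(1)] Npos by (auto simp: divide_simps)
    qed simp
    have qm: "q t i - \<mu> (q t) = t (e i) / N t" if "i \<le> k" for i
      unfolding \<mu> qi[OF that] by (simp add: diff_divide_distrib)
    have "l (q t) = (\<Sum>i\<le>k. t (e i)) / N t"
      unfolding l_def sum_divide_distrib by (intro sum.cong) (simp_all add: qm)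
    also have "(\<Sum>i\<le>k. t (e i)) = 1"
      using sum.reindex_bij_betw[OF e, of t] D(4)[OF t(1)] by simp
    finally have "l (q t) = 1 / N t" .
    then have "p (q t) v = t v" for v
      using inv[of v] Npos D(3)[OF t(1), of v] by (cases "v \<in> \<sigma>") (simp_all add: p_def qm)
    then have "p (q t) = t" by (rule ext)
    with \<open>q t \<in> ksphere k\<close> show "q t \<in> ksphere k \<and> p (q t) = t" by simp
  qed
qed

lemma diam_le_subset: "diam_le V S B s \<Longrightarrow> A \<subseteq> B \<Longrightarrow> diam_le V S A s"
  unfolding diam_le_def by blast

text \<open>The extension is \<open>g \<circ> q\<close>, where \<open>g\<close> fills the sphere map
  \<open>F \<circ> p\<close>; it agrees with \<open>F\<close> on \<open>B\<close> because
  \<open>p\<close> undoes \<open>q\<close> there. The diameter bounds carry over, since composing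
  with \<open>p\<close> or \<open>q\<close> on the inside can only shrink an image.\<close>

lemma simplex_boundary_extension:
  assumes X: "is_complex W R" "\<sigma> \<in> R" "card \<sigma> = Suc k"
    and Y: "is_complex V S"
    and fill: "\<And>f. \<lbrakk>metric_cont V S k (ksphere k) f; diam_le V S (f ` ksphere k) s\<rbrakk>
      \<Longrightarrow> \<exists>g. metric_cont V S k (kdisc k) g \<and> (\<forall>x\<in>ksphere k. g x = f x)
            \<and> diam_le V S (g ` kdisc k) T"
    and B: "B = {x \<in> closed_simplex W R \<sigma>. supp x \<noteq> \<sigma>}"
    and F: "continuous_on B F" "F ` B \<subseteq> realis V S" "diam_le V S (F ` B) s"
  obtains G where "continuous_on (closed_simplex W R \<sigma>) G"
    "G ` closed_simplex W R \<sigma> \<subseteq> realis V S" "\<And>x. x \<in> B \<Longrightarrow> G x = F x"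
    "diam_le V S (G ` closed_simplex W R \<sigma>) T"
proof -
  obtain p q where
    q: "continuous_on (closed_simplex W R \<sigma>) q" "q ` closed_simplex W R \<sigma> \<subseteq> kdisc k" and
    p: "continuous_on (ksphere k) p" "p ` ksphere k \<subseteq> B" and
    pq': "\<And>x. \<lbrakk>x \<in> closed_simplex W R \<sigma>; supp x \<noteq> \<sigma>\<rbrakk> \<Longrightarrow> q x \<in> ksphere k \<and> p (q x) = x"
    unfolding B by (rule simplex_disc_maps[OF X]) blast
  have pq: "q x \<in> ksphere k \<and> p (q x) = x" if "x \<in> B" for x
    using pq' that by (simp add: B)
  have "metric_cont V S k (ksphere k) (F \<circ> p)"
  proof (rule continuous_on_imp_metric_cont[OF Y])
    show "continuous_on (ksphere k) (F \<circ> p)"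
      using p F(1) by (meson continuous_on_compose continuous_on_subset)
    show "(F \<circ> p) ` ksphere k \<subseteq> realis V S" using p(2) F(2) by auto
  qed (simp add: ksphere_def)
  moreover have "diam_le V S ((F \<circ> p) ` ksphere k) s"
    by (rule diam_le_subset[OF F(3)]) (use p(2) in auto)
  ultimately obtain g where g: "metric_cont V S k (kdisc k) g"
    "\<And>x. x \<in> ksphere k \<Longrightarrow> g x = F (p x)" "diam_le V S (g ` kdisc k) T"
    using fill[of "F \<circ> p"] by auto
  show thesis
  proof (rule that[of "g \<circ> q"])
    have "continuous_on (kdisc k) g" using Y g(1) by (rule metric_cont_imp_continuous_on)
    then show "continuous_on (closed_simplex W R \<sigma>) (g \<circ> q)"
      using q by (meson continuous_on_compose continuous_on_subset)
    show "(g \<circ> q) ` closed_simplex W R \<sigma> \<subseteq> realis V S"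
      using g(1) q(2) by (auto simp: metric_cont_def)
    show "(g \<circ> q) x = F x" if "x \<in> B" for x
      using g(2) pq[OF that] by simp
    show "diam_le V S ((g \<circ> q) ` closed_simplex W R \<sigma>) T"
      by (rule diam_le_subset[OF g(3)]) (use q(2) in auto)
  qed
qed

section \<open>Adjacency of vertices\<close>

text \<open>In a complex every vertex is adjacent to itself, as \<open>{v, v}\<close> is the simplex
  \<open>{v}\<close>. Hence \<open>adj S ^^ n\<close> relates vertices at graph distance at most
  \<open>n\<close>, not exactly \<open>n\<close>.\<close>

definition adj :: "'a set set \<Rightarrow> ('a \<times> 'a) set" where
  "adj S = {(v, w). {v, w} \<in> S}"

definition vertex_pt :: "'a \<Rightarrow> 'a \<Rightarrow> real" where
  "vertex_pt v = (\<lambda>w. if w = v then 1 else 0)"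

lemma supp_vertex_pt [simp]: "supp (vertex_pt v) = {v}"
  by (auto simp: supp_def vertex_pt_def)

lemma vertex_pt_realis: "is_complex V S \<Longrightarrow> v \<in> V \<Longrightarrow> vertex_pt v \<in> realis V S"
  by (auto simp: realis_def is_complex_def) (auto simp: vertex_pt_def)

lemma inj_vertex_pt: "inj vertex_pt"
  by (metis injI singleton_inject supp_vertex_pt)

lemma adj_in_vertices:
  assumes "is_complex V S" "(v, w) \<in> adj S"
  shows "v \<in> V" "w \<in> V"
  using assms by (auto simp: adj_def is_complex_def)

lemma adj_refl: "is_complex V S \<Longrightarrow> v \<in> V \<Longrightarrow> (v, v) \<in> adj S"
  by (simp add: adj_def is_complex_def)

lemma sym_adj: "sym (adj S)"
  by (simp add: sym_def adj_def insert_commute)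

lemma simplex_adj:
  assumes "is_complex V S" "U \<in> S" "v \<in> U" "w \<in> U"
  shows "(v, w) \<in> adj S"
  using simplex_subset[OF assms(1,2), of "{v, w}"] assms(3,4) by (simp add: adj_def)

lemma adj_relpow_mono:
  assumes "is_complex V S" "(v, w) \<in> adj S ^^ n" "n \<le> N" "w \<in> V"
  shows "(v, w) \<in> adj S ^^ N"
  using assms(3)
proof (induction N rule: dec_induct)
  case (step N)
  then show ?case using adj_refl[OF assms(1,4)] by auto
qed (rule assms(2))

lemma adj_relpow_sym: "(v, w) \<in> adj S ^^ n \<Longrightarrow> (w, v) \<in> adj S ^^ n"
proof (induction n arbitrary: w)
  case (Suc n)
  then obtain u where "(v, u) \<in> adj S ^^ n" "(u, w) \<in> adj S" by auto
  then have "(u, v) \<in> adj S ^^ n" "(w, u) \<in> adj S" using Suc.IH sym_adj[of S] by (auto dest: symD)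
  then show ?case by (rule relpow_Suc_I2[rotated])
qed simp

text \<open>One step leads from a vertex to at most \<open>D\<close> neighbours or back to itself,
  hence the base \<open>Suc D\<close>.\<close>

lemma card_adj_ball:
  assumes S: "is_complex V S"
    and D: "\<And>s. s \<in> V \<Longrightarrow> finite {t. t \<noteq> s \<and> {s,t} \<in> S} \<and> card {t. t \<noteq> s \<and> {s,t} \<in> S} \<le> D"
    and v: "v \<in> V"
  shows "finite ((adj S ^^ n) `` {v}) \<and> card ((adj S ^^ n) `` {v}) \<le> (Suc D) ^ n
    \<and> (adj S ^^ n) `` {v} \<subseteq> V"
proof (induction n)
  case 0
  then show ?case using v by simp
next
  case (Suc n)
  let ?B = "(adj S ^^ n) `` {v}"
  have eq: "(adj S ^^ Suc n) `` {v} = (\<Union>u\<in>?B. adj S `` {u})"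
    by auto
  have one: "finite (adj S `` {u})" "card (adj S `` {u}) \<le> Suc D" "adj S `` {u} \<subseteq> V" if "u \<in> V" for u
  proof -
    have sub: "adj S `` {u} \<subseteq> insert u {t. t \<noteq> u \<and> {u,t} \<in> S}" by (auto simp: adj_def)
    have fin: "finite (insert u {t. t \<noteq> u \<and> {u,t} \<in> S})" using D[OF that] by simp
    show "finite (adj S `` {u})" using sub fin by (rule finite_subset)
    have "card (adj S `` {u}) \<le> card (insert u {t. t \<noteq> u \<and> {u,t} \<in> S})"
      using sub fin by (simp only: card_mono)
    also have "\<dots> \<le> Suc D" using D[OF that] by (simp add: card_insert_if)
    finally show "card (adj S `` {u}) \<le> Suc D" .
    show "adj S `` {u} \<subseteq> V" using adj_in_vertices[OF S] by auto
  qed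
  have B: "finite ?B" "card ?B \<le> Suc D ^ n" "?B \<subseteq> V" using Suc.IH by auto
  have "card (\<Union>u\<in>?B. adj S `` {u}) \<le> (\<Sum>u\<in>?B. card (adj S `` {u}))"
    using B(1) by (rule card_UN_le)
  also have "\<dots> \<le> (\<Sum>u\<in>?B. Suc D)" using one(2) B(3) by (intro sum_mono) auto
  also have "\<dots> \<le> Suc D ^ Suc n" using mult_le_mono2[OF B(2), of "Suc D"] by (simp add: mult.commute)
  finally have "card (\<Union>u\<in>?B. adj S `` {u}) \<le> Suc D ^ Suc n" .
  moreover have "finite (\<Union>u\<in>?B. adj S `` {u})" using B one(1) by (intro finite_UN_I) auto
  moreover have "(\<Union>u\<in>?B. adj S `` {u}) \<subseteq> V" using B(3) one(3) by blast
  ultimately show ?case unfolding eq by blast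
qed

lemma cdist_vertex_pt_le:
  assumes S: "is_complex V S" and "v \<in> V" "(v, w) \<in> adj S ^^ n"
  shows "cdist V S (vertex_pt v) (vertex_pt w) \<le> ereal (2 * real n)"
  using assms(3)
proof (induction n arbitrary: w)
  case 0
  then show ?case using cdist_refl_le[OF vertex_pt_realis[OF S assms(2)]] by (simp add: zero_ereal_def)
next
  case (Suc n)
  then obtain u where u: "(v, u) \<in> adj S ^^ n" "(u, w) \<in> adj S" by auto
  \<comment> \<open>Comparison with the sum of absolute values is crude, but any uniform bound per
    edge serves.\<close>
  have "l2dist (vertex_pt u) (vertex_pt w) \<le> (\<Sum>x\<in>{u,w}. \<bar>vertex_pt u x - vertex_pt w x\<bar>)"
    using L2_set_le_sum_abs[of "\<lambda>x. vertex_pt u x - vertex_pt w x" "{u,w}"]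
    by (simp add: l2dist_def L2_set_def insert_commute)
  also have "\<dots> \<le> 2"
    by (cases "u = w") (auto simp: vertex_pt_def)
  finally have l: "l2dist (vertex_pt u) (vertex_pt w) \<le> 2" .
  have "supp (vertex_pt u) \<union> supp (vertex_pt w) \<in> S"
    using u(2) by (simp add: adj_def insert_commute)
  then have "cdist V S (vertex_pt v) (vertex_pt w)
      \<le> cdist V S (vertex_pt v) (vertex_pt u) + ereal (l2dist (vertex_pt u) (vertex_pt w))"
    using vertex_pt_realis[OF S adj_in_vertices(2)[OF S u(2)]] by (intro cdist_append)
  also have "\<dots> \<le> ereal (2 * real n) + ereal 2"
    using Suc.IH[OF u(1)] l by (intro add_mono) auto
  finally show ?case by (simp add: add.commute)
qed

text \<open>The graph distance to \<open>v\<close>, truncated at \<open>N\<close>, extends affinely over simplices to a function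
  that is Lipschitz along chains, because it varies by at most 1 on each simplex.\<close>

lemma supp_in_adj_ball:
  assumes S: "is_complex V S" and D: "\<And>U. U \<in> S \<Longrightarrow> card U \<le> Suc D"
    and x: "x \<in> realis V S" and y: "y \<in> realis V S" and d: "cdist V S x y < ereal t"
    and v: "v \<in> supp x" and w: "w \<in> supp y" and N: "real N > 2 + real (Suc D) * t"
  shows "(v, w) \<in> adj S ^^ N"
proof -
  \<comment> \<open>Since the relations \<open>adj S ^^ n\<close> increase with \<open>n\<close> on
    vertices, counting the failures below \<open>N\<close> gives the graph distance cut off at
    \<open>N\<close>, also for unreachable vertices.\<close>
  define \<rho> where "\<rho> = (\<lambda>w. card {n. n < N \<and> (v, w) \<notin> adj S ^^ n})"
  define H where "H = (\<lambda>f. \<Sum>u\<in>supp f. f u * real (\<rho> u))"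
  have step: "\<rho> b \<le> Suc (\<rho> a)" if "(a, b) \<in> adj S" for a b
  proof -
    \<comment> \<open>A failure for \<open>b\<close> at a positive \<open>n\<close> is a failure for
      \<open>a\<close> at \<open>n - 1\<close>; the value \<open>n = 0\<close> accounts for the
      extra 1.\<close>
    have "{n. n < N \<and> (v, b) \<notin> adj S ^^ n} \<subseteq> insert 0 (Suc ` {n. n < N \<and> (v, a) \<notin> adj S ^^ n})"
    proof
      fix n assume n: "n \<in> {n. n < N \<and> (v, b) \<notin> adj S ^^ n}"
      show "n \<in> insert 0 (Suc ` {n. n < N \<and> (v, a) \<notin> adj S ^^ n})"
      proof (cases n)
        case (Suc m)
        then have "(v, a) \<notin> adj S ^^ m" using n that by auto
        then show ?thesis using Suc n by auto
      qed simp
    qed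
    then have "\<rho> b \<le> card (insert 0 (Suc ` {n. n < N \<and> (v, a) \<notin> adj S ^^ n}))"
      unfolding \<rho>_def by (intro card_mono) auto
    also have "\<dots> \<le> Suc (card (Suc ` {n. n < N \<and> (v, a) \<notin> adj S ^^ n}))"
      by (simp add: card_insert_if)
    also have "card (Suc ` {n. n < N \<and> (v, a) \<notin> adj S ^^ n}) = \<rho> a"
      unfolding \<rho>_def by (rule card_image) simp
    finally show ?thesis .
  qed
  have simplex: "\<rho> b \<le> Suc (\<rho> a)" if "U \<in> S" "a \<in> U" "b \<in> U" for U a b
    using step simplex_adj[OF S that] .
  have supp: "supp f \<in> S" if "f \<in> realis V S" for f using that by (simp add: realis_def)
  have H_sup: "H f = (\<Sum>u\<in>A. f u * real (\<rho> u))" if "finite A" "supp f \<subseteq> A" for f A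
    unfolding H_def using that by (intro sum.mono_neutral_left) (auto simp: supp_def)
  have lip: "\<bar>H f - H g\<bar> \<le> real (Suc D) * l2dist f g"
    if f: "f \<in> realis V S" and g: "g \<in> realis V S" and U: "supp f \<union> supp g \<in> S" for f g
  proof -
    let ?A = "supp f \<union> supp g"
    have fin: "finite ?A" using simplex_finite[OF S U] .
    obtain a where a: "a \<in> ?A" using realis_supp_nonempty[OF f] by blast
    have "sum f ?A = 1" "sum g ?A = 1"
      using realis_sum_superset[OF f fin] realis_sum_superset[OF g fin] by auto
    \<comment> \<open>Both masses are 1, so a constant may be subtracted from \<open>\<rho>\<close>:
      its values, which can be as large as \<open>N\<close>, are replaced by differences of at most
      1.\<close>
    then have "(\<Sum>u\<in>?A. (f u - g u) * real (\<rho> a)) = 0"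
      by (simp add: sum_distrib_right[symmetric] sum_subtractf)
    moreover have "H f - H g = (\<Sum>u\<in>?A. (f u - g u) * real (\<rho> u))"
      using H_sup[OF fin, of f] H_sup[OF fin, of g] by (simp add: sum_subtractf left_diff_distrib)
    ultimately have "H f - H g = (\<Sum>u\<in>?A. (f u - g u) * (real (\<rho> u) - real (\<rho> a)))"
      by (simp add: sum_subtractf right_diff_distrib)
    also have "\<bar>\<dots>\<bar> \<le> (\<Sum>u\<in>?A. l2dist f g)"
    proof (rule order_trans[OF sum_abs sum_mono])
      fix u assume u: "u \<in> ?A"
      have "\<bar>real (\<rho> u) - real (\<rho> a)\<bar> \<le> 1"
        using simplex[OF U u a] simplex[OF U a u] by linarith
      then have "\<bar>f u - g u\<bar> * \<bar>real (\<rho> u) - real (\<rho> a)\<bar> \<le> l2dist f g * 1"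
        using abs_diff_le_l2dist[of f g u] fin by (intro mult_mono) (auto simp: l2dist_nonneg)
      then show "\<bar>(f u - g u) * (real (\<rho> u) - real (\<rho> a))\<bar> \<le> l2dist f g"
        by (simp add: abs_mult)
    qed
    also have "\<dots> = real (card ?A) * l2dist f g" by simp
    also have "\<dots> \<le> real (Suc D) * l2dist f g"
      using D[OF U] by (intro mult_right_mono l2dist_nonneg of_nat_mono)
    finally show ?thesis .
  qed
  have "\<bar>H x - H y\<bar> \<le> real (Suc D) * t"
    by (rule lipschitz_le_cdist[of V S H "real (Suc D)" x y t, OF lip _ d]) auto
  \<comment> \<open>An average of \<open>\<rho>\<close> over a simplex differs by at most 1 from the
    value at one of its vertices. This loss occurs at \<open>v\<close> and again at
    \<open>w\<close>, which explains the 2 in the bound on \<open>N\<close>.\<close>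
  moreover have "H x \<le> 1"
  proof -
    have "\<rho> v = 0"
    proof -
      have "v \<in> V" using v supp[OF x] S by (auto simp: is_complex_def)
      then have "(v, v) \<in> adj S ^^ n" for n
        using adj_relpow_mono[OF S, of v v 0 n] by simp
      then show ?thesis by (simp add: \<rho>_def)
    qed
    then have "\<rho> u \<le> 1" if "u \<in> supp x" for u using simplex[OF supp[OF x] v that] by simp
    then have "H x \<le> (\<Sum>u\<in>supp x. x u * 1)"
      unfolding H_def using realis_nonneg[OF x] by (intro sum_mono mult_left_mono) auto
    then show ?thesis using x by (simp add: realis_def)
  qed
  moreover have "real (\<rho> w) - 1 \<le> H y"
  proof -
    have "real (\<rho> w) - 1 \<le> real (\<rho> u)" if "u \<in> supp y" for u
      using simplex[OF supp[OF y] that w] by linarith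
    then have "(\<Sum>u\<in>supp y. y u * (real (\<rho> w) - 1)) \<le> H y"
      unfolding H_def using realis_nonneg[OF y] by (intro sum_mono mult_left_mono) auto
    then show ?thesis using y by (simp add: realis_def sum_distrib_right[symmetric])
  qed
  ultimately have "real (\<rho> w) < real N" using N by linarith
  have "\<exists>n<N. (v, w) \<in> adj S ^^ n"
  proof (rule ccontr)
    assume "\<not> ?thesis"
    then have "\<rho> w = card {n. n < N}" unfolding \<rho>_def by (intro arg_cong[of _ _ card]) blast
    then show False using \<open>real (\<rho> w) < real N\<close> by simp
  qed
  then obtain n where n: "n < N" "(v, w) \<in> adj S ^^ n" by blast
  have "w \<in> V" using w supp[OF y] S by (auto simp: is_complex_def)
  then show ?thesis using adj_relpow_mono[OF S n(2)] n(1) by simp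
qed

text \<open>Adjacent vertices have distance at most 1, so their images are joined by a path of
  length at most \<open>L\<close>, which loops pad to length exactly \<open>L\<close>.\<close>

lemma regular_map_adj:
  assumes X: "is_complex VX SX" and Y: "is_complex VY SY" and reg: "regular_map VX SX VY SY \<phi>"
  obtains L where "\<And>v w. (v, w) \<in> adj SX \<Longrightarrow> (\<phi> v, \<phi> w) \<in> adj SY ^^ L"
proof -
  obtain L :: nat where
    L: "\<And>x y. \<lbrakk>x \<in> VX; y \<in> VX\<rbrakk> \<Longrightarrow> edge_dist VY SY (\<phi> x) (\<phi> y) \<le> enat L * edge_dist VX SX x y"
    using reg unfolding regular_map_def by blast
  have \<phi>: "\<phi> ` VX \<subseteq> VY" using reg unfolding regular_map_def by blast
  have "(\<phi> v, \<phi> w) \<in> adj SY ^^ L" if vw: "(v, w) \<in> adj SX" for v w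
  proof -
    note V = adj_in_vertices[OF X vw]
    have "edge_dist VX SX v w \<le> enat 1"
      unfolding edge_dist_def
    proof (rule Inf_lower, rule CollectI, intro exI conjI)
      define p where "p = (\<lambda>i::nat. if i = 0 then v else w)"
      show "p 0 = v" "p 1 = w" "\<forall>i\<le>1. p i \<in> VX" "\<forall>i<1. {p i, p (Suc i)} \<in> SX"
        using V vw by (auto simp: p_def adj_def)
    qed simp
    then have "enat L * edge_dist VX SX v w \<le> enat L * enat 1"
      by (intro mult_left_mono) auto
    then have le: "edge_dist VY SY (\<phi> v) (\<phi> w) \<le> enat L"
      using L[OF V] by simp
    \<comment> \<open>A strict bound on the infimum yields an actual path.\<close>
    then have "edge_dist VY SY (\<phi> v) (\<phi> w) < enat (Suc L)"
      using enat_ord_simps(2) le_less_trans lessI by blast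
    then obtain n p where np: "enat n < enat (Suc L)" "p 0 = \<phi> v" "p n = \<phi> w"
      "\<forall>i<n. {p i, p (Suc i)} \<in> SY"
      unfolding edge_dist_def Inf_less_iff by blast
    have "n \<le> L" using np(1) by simp
    have "(\<phi> v, \<phi> w) \<in> adj SY ^^ n"
      unfolding relpow_fun_conv using np by (intro exI[of _ p]) (simp add: adj_def)
    then show ?thesis
      using adj_relpow_mono[OF Y _ \<open>n \<le> L\<close>] V \<phi> by blast
  qed
  then show thesis using that by blast
qed

section \<open>Filling skeleta\<close>

lemma vertex_pt_closed_simplex:
  assumes "is_complex V S" "\<sigma> \<in> S" "v \<in> \<sigma>"
  shows "vertex_pt v \<in> closed_simplex V S \<sigma>"
proof -
  have "v \<in> V" using assms by (auto simp: is_complex_def)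
  then show ?thesis using vertex_pt_realis[OF assms(1)] assms(3) by (simp add: closed_simplex_def)
qed

lemma closed_simplex_singleton:
  assumes "x \<in> closed_simplex V S {v}"
  shows "x = vertex_pt v"
proof
  have sub: "supp x \<subseteq> {v}" and x: "x \<in> realis V S" using assms by (auto simp: closed_simplex_def)
  have "x v = 1" using realis_sum_superset[OF x _ sub] by simp
  then show "x w = vertex_pt v w" for w using sub by (auto simp: vertex_pt_def supp_def)
qed

lemma diam_le_mono:
  assumes "diam_le V S B s" "s \<le> t"
  shows "diam_le V S B t"
  unfolding diam_le_def
proof (intro ballI)
  fix x y assume "x \<in> B" "y \<in> B"
  then have "cdist V S x y \<le> ereal s" using assms(1) unfolding diam_le_def by blast
  also have "\<dots> \<le> ereal t" using assms(2) by simp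
  finally show "cdist V S x y \<le> ereal t" .
qed

lemma boundary_eq_Union_faces:
  "{x \<in> closed_simplex V S \<sigma>. supp x \<noteq> \<sigma>} = (\<Union>v\<in>\<sigma>. closed_simplex V S (\<sigma> - {v}))"
proof -
  have "supp x \<subseteq> \<sigma> \<and> supp x \<noteq> \<sigma> \<longleftrightarrow> (\<exists>v\<in>\<sigma>. supp x \<subseteq> \<sigma> - {v})" for x :: "'a \<Rightarrow> real"
    by blast
  then show ?thesis unfolding closed_simplex_def by blast
qed

text \<open>Continuity is claimed on each closed simplex separately, as there may be infinitely many
  of them. The values on vertices are carried through the induction because they are what bounds the
  image of a boundary: all faces of a simplex are tied to nearby vertices. The bound
  \<open>T\<close> may grow from one skeleton to the next.\<close>

lemma skeleton_extension:
  assumes X: "is_complex VX SX" and Y: "is_complex VY SY"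
    and conn: "\<forall>k. 1 \<le> k \<and> k \<le> d \<longrightarrow> unif_connected VY SY k"
    and \<phi>: "\<phi> ` VX \<subseteq> VY"
    and edge: "\<And>v w. (v, w) \<in> adj SX \<Longrightarrow> cdist VY SY (vertex_pt (\<phi> v)) (vertex_pt (\<phi> w)) \<le> ereal L"
    and "n \<le> d"
  shows "\<exists>\<Phi> T. (\<forall>v\<in>VX. \<Phi> (vertex_pt v) = vertex_pt (\<phi> v)) \<and>
    (\<forall>\<sigma>\<in>SX. card \<sigma> \<le> Suc n \<longrightarrow> continuous_on (closed_simplex VX SX \<sigma>) \<Phi> \<and>
       \<Phi> ` closed_simplex VX SX \<sigma> \<subseteq> realis VY SY \<and> diam_le VY SY (\<Phi> ` closed_simplex VX SX \<sigma>) T)"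
  using \<open>n \<le> d\<close>
proof (induction n)
  case 0
  \<comment> \<open>The values off the vertices are arbitrary; closed simplices with at most one
    vertex do not see them.\<close>
  define \<Phi> where "\<Phi> = (\<lambda>x. vertex_pt (\<phi> (inv vertex_pt x)))"
  have \<Phi>: "\<Phi> (vertex_pt v) = vertex_pt (\<phi> v)" for v
    by (simp add: \<Phi>_def inv_f_f[OF inj_vertex_pt])
  have "continuous_on (closed_simplex VX SX \<sigma>) \<Phi> \<and>
       \<Phi> ` closed_simplex VX SX \<sigma> \<subseteq> realis VY SY \<and> diam_le VY SY (\<Phi> ` closed_simplex VX SX \<sigma>) 0"
    if "\<sigma> \<in> SX" "card \<sigma> \<le> Suc 0" for \<sigma>
  proof (cases "\<sigma> = {}")
    case True
    then have "closed_simplex VX SX \<sigma> = {}"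
      using realis_supp_nonempty by (fastforce simp: closed_simplex_def)
    then show ?thesis by (simp add: diam_le_def)
  next
    case False
    then have "card \<sigma> = 1" using that simplex_finite[OF X] by (simp add: le_Suc_eq)
    then obtain v where v: "\<sigma> = {v}" by (auto simp: card_1_singleton_iff)
    have "v \<in> VX" using X that(1) v by (auto simp: is_complex_def)
    then have R: "vertex_pt (\<phi> v) \<in> realis VY SY" using vertex_pt_realis[OF Y] \<phi> by blast
    have eq: "x = vertex_pt v" if "x \<in> closed_simplex VX SX \<sigma>" for x
      by (rule closed_simplex_singleton) (use that v in simp)
    have const: "\<Phi> x = vertex_pt (\<phi> v)" if "x \<in> closed_simplex VX SX \<sigma>" for x
      using eq[OF that] \<Phi>[of v] by simp
    have "continuous_on (closed_simplex VX SX \<sigma>) \<Phi>"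
      by (rule iffD2[OF continuous_on_cong[OF refl const] continuous_on_const])
    moreover have "\<Phi> ` closed_simplex VX SX \<sigma> \<subseteq> realis VY SY" using const R by auto
    moreover have "diam_le VY SY (\<Phi> ` closed_simplex VX SX \<sigma>) 0"
      using cdist_refl_le[OF R] const by (auto simp: diam_le_def zero_ereal_def)
    ultimately show ?thesis by blast
  qed
  then show ?case using \<Phi> by (intro exI[of _ \<Phi>] exI[of _ 0]) simp
next
  case (Suc n)
  then obtain \<Phi> T where \<Phi>v: "\<And>v. v \<in> VX \<Longrightarrow> \<Phi> (vertex_pt v) = vertex_pt (\<phi> v)"
    and \<Phi>: "\<And>\<sigma>. \<lbrakk>\<sigma> \<in> SX; card \<sigma> \<le> Suc n\<rbrakk> \<Longrightarrow> continuous_on (closed_simplex VX SX \<sigma>) \<Phi> \<and>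
       \<Phi> ` closed_simplex VX SX \<sigma> \<subseteq> realis VY SY \<and> diam_le VY SY (\<Phi> ` closed_simplex VX SX \<sigma>) T"
    using Suc_leD[OF Suc.prems] by blast
  note \<Phi>c = \<Phi>[THEN conjunct1] and \<Phi>i = \<Phi>[THEN conjunct2, THEN conjunct1]
    and \<Phi>d = \<Phi>[THEN conjunct2, THEN conjunct2]
  have "unif_connected VY SY (Suc n)" using conn Suc.prems by simp
  \<comment> \<open>\<open>T'\<close> is fixed before any simplex is considered, hence uniform. The
    bound \<open>T + (L + T)\<close> comes from moving to a vertex within one face, across an edge,
    and from there to the second point within its face.\<close>
  then have "\<exists>T'. \<forall>f. metric_cont VY SY (Suc n) (ksphere (Suc n)) f \<and>
      diam_le VY SY (f ` ksphere (Suc n)) (T + (L + T)) \<longrightarrow>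
      (\<exists>g. metric_cont VY SY (Suc n) (kdisc (Suc n)) g \<and> (\<forall>x\<in>ksphere (Suc n). g x = f x)
            \<and> diam_le VY SY (g ` kdisc (Suc n)) T')"
    unfolding unif_connected_def by (rule spec)
  then obtain T' where "\<forall>f. metric_cont VY SY (Suc n) (ksphere (Suc n)) f \<and>
      diam_le VY SY (f ` ksphere (Suc n)) (T + (L + T)) \<longrightarrow>
      (\<exists>g. metric_cont VY SY (Suc n) (kdisc (Suc n)) g \<and> (\<forall>x\<in>ksphere (Suc n). g x = f x)
            \<and> diam_le VY SY (g ` kdisc (Suc n)) T')" ..
  note T' = this[rule_format, OF conjI]
  define E where "E \<sigma> G \<longleftrightarrow> continuous_on (closed_simplex VX SX \<sigma>) G \<and>
     G ` closed_simplex VX SX \<sigma> \<subseteq> realis VY SY \<and>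
     (\<forall>x. x \<in> closed_simplex VX SX \<sigma> \<longrightarrow> supp x \<noteq> \<sigma> \<longrightarrow> G x = \<Phi> x) \<and>
     diam_le VY SY (G ` closed_simplex VX SX \<sigma>) T'" for \<sigma> G
  have ex: "\<exists>G. E \<sigma> G"
    if \<sigma>: "\<sigma> \<in> SX" "card \<sigma> = Suc (Suc n)" for \<sigma>
  proof -
    define B where "B = {x \<in> closed_simplex VX SX \<sigma>. supp x \<noteq> \<sigma>}"
    have fin: "finite \<sigma>" using simplex_finite[OF X \<sigma>(1)] .
    have face: "\<sigma> - {v} \<in> SX" "card (\<sigma> - {v}) \<le> Suc n" if "v \<in> \<sigma>" for v
      using simplex_subset[OF X \<sigma>(1), of "\<sigma> - {v}"] \<sigma>(2) fin that by (auto simp: card_Diff_singleton)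
    have BU: "B = (\<Union>v\<in>\<sigma>. closed_simplex VX SX (\<sigma> - {v}))"
      unfolding B_def by (rule boundary_eq_Union_faces)
    have cont: "continuous_on B \<Phi>"
      unfolding BU using fin closed_closed_simplex[OF X face(1)] \<Phi>c[OF face]
      by (rule continuous_on_closed_Union)
    have im: "\<Phi> ` B \<subseteq> realis VY SY"
      unfolding BU using \<Phi>i[OF face] by blast
    have near: "\<exists>v\<in>\<sigma>. cdist VY SY (\<Phi> x) (vertex_pt (\<phi> v)) \<le> ereal T" if x: "x \<in> B" for x
    proof -
      obtain a where a: "a \<in> \<sigma>" "x \<in> closed_simplex VX SX (\<sigma> - {a})" using x BU by blast
      then obtain v where v: "v \<in> supp x" using realis_supp_nonempty[of x VX SX]
        by (auto simp: closed_simplex_def)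
      then have v': "v \<in> \<sigma> - {a}" using a(2) by (auto simp: closed_simplex_def)
      then have "v \<in> VX" using X \<sigma>(1) by (auto simp: is_complex_def)
      then have "vertex_pt (\<phi> v) \<in> \<Phi> ` closed_simplex VX SX (\<sigma> - {a})"
        using \<Phi>v vertex_pt_closed_simplex[OF X face(1)[OF a(1)] v'] by force
      then have "cdist VY SY (\<Phi> x) (vertex_pt (\<phi> v)) \<le> ereal T"
        using \<Phi>d[OF face[OF a(1)]] a(2) unfolding diam_le_def by blast
      with v' show ?thesis by blast
    qed
    have diam: "diam_le VY SY (\<Phi> ` B) (T + (L + T))"
      unfolding diam_le_def
    proof (intro ballI, elim imageE, hypsubst)
      fix x y assume "x \<in> B" "y \<in> B"
      then obtain v w where vw: "v \<in> \<sigma>" "w \<in> \<sigma>"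
        and x: "cdist VY SY (\<Phi> x) (vertex_pt (\<phi> v)) \<le> ereal T"
        and y: "cdist VY SY (\<Phi> y) (vertex_pt (\<phi> w)) \<le> ereal T"
        using near[of x] near[of y] by blast
      have "cdist VY SY (vertex_pt (\<phi> v)) (\<Phi> y)
          \<le> cdist VY SY (vertex_pt (\<phi> v)) (vertex_pt (\<phi> w)) + cdist VY SY (vertex_pt (\<phi> w)) (\<Phi> y)"
        by (rule cdist_triangle)
      also have "\<dots> \<le> ereal L + ereal T"
        using edge[OF simplex_adj[OF X \<sigma>(1) vw]] y cdist_commute[of VY SY "\<Phi> y"]
        by (intro add_mono) auto
      finally have "cdist VY SY (vertex_pt (\<phi> v)) (\<Phi> y) \<le> ereal L + ereal T" .
      then have "cdist VY SY (\<Phi> x) (\<Phi> y) \<le> ereal T + (ereal L + ereal T)"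
        by (rule order_trans[OF cdist_triangle add_mono[OF x]])
      then show "cdist VY SY (\<Phi> x) (\<Phi> y) \<le> ereal (T + (L + T))" by simp
    qed
    obtain G where "continuous_on (closed_simplex VX SX \<sigma>) G"
      "G ` closed_simplex VX SX \<sigma> \<subseteq> realis VY SY" "\<And>x. x \<in> B \<Longrightarrow> G x = \<Phi> x"
      "diam_le VY SY (G ` closed_simplex VX SX \<sigma>) T'"
      by (rule simplex_boundary_extension[OF X \<sigma> Y _ B_def cont im diam], erule (1) T', rule that)
    then have "E \<sigma> G" unfolding E_def B_def by simp
    then show ?thesis by (rule exI[of "E \<sigma>" G])
  qed
  define G where "G \<sigma> = (SOME G. E \<sigma> G)" for \<sigma>
  have G: "E \<sigma> (G \<sigma>)" if "\<sigma> \<in> SX" "card \<sigma> = Suc (Suc n)" for \<sigma>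
    unfolding G_def using ex[OF that] by (rule someI_ex)
  \<comment> \<open>A point whose support has \<open>n + 2\<close> vertices is interior to exactly
    one simplex, its support, so independently chosen fillings never collide.\<close>
  define \<Psi> where "\<Psi> = (\<lambda>x. if card (supp x) = Suc (Suc n) then G (supp x) x else \<Phi> x)"
  have "continuous_on (closed_simplex VX SX \<sigma>) \<Psi> \<and> \<Psi> ` closed_simplex VX SX \<sigma> \<subseteq> realis VY SY \<and>
      diam_le VY SY (\<Psi> ` closed_simplex VX SX \<sigma>) (max T T')"
    if \<sigma>: "\<sigma> \<in> SX" "card \<sigma> \<le> Suc (Suc n)" for \<sigma>
  proof -
    have fin: "finite \<sigma>" using simplex_finite[OF X \<sigma>(1)] .
    have sub: "supp x \<subseteq> \<sigma>" if "x \<in> closed_simplex VX SX \<sigma>" for x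
      using that by (simp add: closed_simplex_def)
    have "\<exists>F. continuous_on (closed_simplex VX SX \<sigma>) F \<and> F ` closed_simplex VX SX \<sigma> \<subseteq> realis VY SY \<and>
      diam_le VY SY (F ` closed_simplex VX SX \<sigma>) (max T T') \<and> (\<forall>x\<in>closed_simplex VX SX \<sigma>. \<Psi> x = F x)"
    proof (cases "card \<sigma> = Suc (Suc n)")
      case True
      \<comment> \<open>On the boundary the support is smaller, so \<open>\<Psi>\<close> is
        \<open>\<Phi>\<close> there, with which the filling agrees by \<open>E\<close>.\<close>
      have "\<Psi> x = G \<sigma> x" if x: "x \<in> closed_simplex VX SX \<sigma>" for x
      proof (cases "supp x = \<sigma>")
        case False
        then have "card (supp x) < Suc (Suc n)"
          using psubset_card_mono[OF fin, of "supp x"] sub[OF x] True by auto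
        then show ?thesis using G[OF \<sigma>(1) True] x False by (simp add: \<Psi>_def E_def)
      qed (simp add: \<Psi>_def True)
      moreover have "diam_le VY SY (G \<sigma> ` closed_simplex VX SX \<sigma>) (max T T')"
        by (rule diam_le_mono[of _ _ _ T']) (use G[OF \<sigma>(1) True] in \<open>simp_all add: E_def\<close>)
      ultimately show ?thesis
        using G[OF \<sigma>(1) True] by (intro exI[of _ "G \<sigma>"]) (simp add: E_def)
    next
      case False
      then have c: "card \<sigma> \<le> Suc n" using \<sigma>(2) by simp
      have "\<Psi> x = \<Phi> x" if x: "x \<in> closed_simplex VX SX \<sigma>" for x
        using card_mono[OF fin sub[OF x]] c by (simp add: \<Psi>_def)
      moreover have "diam_le VY SY (\<Phi> ` closed_simplex VX SX \<sigma>) (max T T')"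
        using \<Phi>d[OF \<sigma>(1) c] by (rule diam_le_mono) simp
      ultimately show ?thesis
        using \<Phi>c[OF \<sigma>(1) c] \<Phi>i[OF \<sigma>(1) c] by (intro exI[of _ \<Phi>]) simp
    qed
    then obtain F where F: "continuous_on (closed_simplex VX SX \<sigma>) F"
      "F ` closed_simplex VX SX \<sigma> \<subseteq> realis VY SY"
      "diam_le VY SY (F ` closed_simplex VX SX \<sigma>) (max T T')"
      and eq: "\<And>x. x \<in> closed_simplex VX SX \<sigma> \<Longrightarrow> \<Psi> x = F x"
      by blast
    have "\<Psi> ` closed_simplex VX SX \<sigma> = F ` closed_simplex VX SX \<sigma>"
      using eq by (rule image_cong[OF refl])
    moreover have "continuous_on (closed_simplex VX SX \<sigma>) \<Psi>"
      by (rule iffD2[OF continuous_on_cong[OF refl eq] F(1)])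
    ultimately show ?thesis using F by simp
  qed
  moreover have "\<forall>v\<in>VX. \<Psi> (vertex_pt v) = vertex_pt (\<phi> v)" using \<Phi>v by (simp add: \<Psi>_def)
  ultimately show ?case by (intro exI[of _ \<Psi>] exI[of _ "max T T'"]) simp
qed

section \<open>Comparison of topological overlaps\<close>

text \<open>\<open>Sup\<close> on \<open>nat\<close> is a genuine upper bound only for bounded sets;
  finiteness of \<open>S\<close> supplies the bound \<open>card S\<close>.\<close>

lemma card_le_sOv:
  assumes "finite S"
  shows "card {\<sigma>\<in>S. z \<in> f ` closed_simplex V S \<sigma>} \<le> sOv V S f"
  unfolding sOv_def
proof (rule cSup_upper)
  show "bdd_above {card {\<sigma>\<in>S. z \<in> f ` closed_simplex V S \<sigma>} | z. True}"
    using assms by (auto intro!: bdd_aboveI[of _ "card S"] card_mono)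
qed blast

lemma sOv_least:
  assumes "\<And>z. card {\<sigma>\<in>S. z \<in> f ` closed_simplex V S \<sigma>} \<le> b"
  shows "sOv V S f \<le> b"
  unfolding sOv_def
proof (rule cSup_least)
  fix n assume "n \<in> {card {\<sigma>\<in>S. z \<in> f ` closed_simplex V S \<sigma>} | z. True}"
  then obtain z where "n = card {\<sigma>\<in>S. z \<in> f ` closed_simplex V S \<sigma>}" by (elim CollectE exE conjE)
  then show "n \<le> b" using assms[of z] by simp
qed auto

lemma sTO_le:
  fixes f :: "('a \<Rightarrow> real) \<Rightarrow> real^'q::finite"
  assumes "continuous_on (realis V S) f"
  shows "sTO TYPE('q) V S \<le> sOv V S f"
  unfolding sTO_def
  by (rule cInf_lower, rule CollectI, intro exI conjI, rule refl, rule assms) simp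

text \<open>A non-empty set of naturals contains its infimum, and constant maps make this one
  non-empty.\<close>

lemma sTO_attained:
  obtains f :: "('a \<Rightarrow> real) \<Rightarrow> real^'q::finite"
  where "continuous_on (realis V S) f" "sOv V S f = sTO TYPE('q) V S"
proof -
  let ?A = "{sOv V S f | f :: ('a \<Rightarrow> real) \<Rightarrow> real^'q. continuous_on (realis V S) f}"
  have "?A \<noteq> {}" using continuous_on_const by blast
  then have "Inf ?A \<in> ?A" by (rule Inf_nat_def1)
  then show thesis using that unfolding sTO_def by auto
qed

lemma complex_subset_Pow: "is_complex V S \<Longrightarrow> S \<subseteq> Pow V"
  unfolding is_complex_def by (simp add: subset_iff)

lemma complex_finite: "is_complex V S \<Longrightarrow> finite V \<Longrightarrow> finite S"
  by (rule finite_subset[OF complex_subset_Pow]) simp_all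

lemma complex_card_le:
  assumes "is_complex V S" "finite V"
  shows "card S \<le> 2 ^ card V"
  using card_mono[OF _ complex_subset_Pow[OF assms(1)]] assms(2) by (simp add: card_Pow)

lemma sTO_le_sTO_X:
  assumes "is_complex (VZ :: 'a set) SZ" "finite VZ" "complex_le VZ SZ VX SX" "card VZ \<le> r"
  shows "sTO TYPE('q::finite) VZ SZ \<le> sTO_X TYPE('q) (VX :: 'a set) SX r"
  unfolding sTO_X_def
proof (rule cSup_upper)
  show "bdd_above {sTO TYPE('q) VZ SZ | (VZ :: 'a set) SZ. is_complex VZ SZ \<and> finite VZ
       \<and> complex_le VZ SZ VX SX \<and> card VZ \<le> r}"
  \<comment> \<open>The overlap of a constant map is at most the number of simplices, which is at
    most \<open>2 ^ r\<close> on at most \<open>r\<close> vertices.\<close>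
  proof (rule bdd_aboveI[of _ "2 ^ r"], elim CollectE exE conjE, hypsubst)
    fix V :: "'a set" and S assume V: "is_complex V S" "finite V" "card V \<le> r"
    have "sTO TYPE('q) V S \<le> sOv V S (\<lambda>_. 0 :: real^'q)" by (intro sTO_le) simp
    also have "\<dots> \<le> card S"
      using complex_finite[OF V(1,2)] by (intro sOv_least card_mono) auto
    also have "\<dots> \<le> 2 ^ card V" using complex_card_le[OF V(1,2)] .
    also have "\<dots> \<le> 2 ^ r" using V(3) by simp
    finally show "sTO TYPE('q) V S \<le> 2 ^ r" .
  qed
qed (rule CollectI, intro exI conjI, rule refl, use assms in simp_all)

lemma sTO_X_least:
  assumes "\<And>(VZ :: 'a set) SZ. \<lbrakk>is_complex VZ SZ; finite VZ; complex_le VZ SZ VX SX; card VZ \<le> r\<rbrakk>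
    \<Longrightarrow> sTO TYPE('q::finite) VZ SZ \<le> b"
  shows "sTO_X TYPE('q) (VX :: 'a set) SX r \<le> b"
  unfolding sTO_X_def
proof (rule cSup_least)
  \<comment> \<open>The complex with no simplices at all, not even the empty one, shows that the
    supremum runs over a non-empty set.\<close>
  have "is_complex ({} :: 'a set) {}" "complex_le ({} :: 'a set) {} VX SX"
    by (auto simp: is_complex_def complex_le_def)
  then show "{sTO TYPE('q) VZ SZ | (VZ :: 'a set) SZ. is_complex VZ SZ \<and> finite VZ
       \<and> complex_le VZ SZ VX SX \<and> card VZ \<le> r} \<noteq> {}" by fastforce
next
  fix n
  assume "n \<in> {sTO TYPE('q) VZ SZ | (VZ :: 'a set) SZ. is_complex VZ SZ \<and> finite VZ
       \<and> complex_le VZ SZ VX SX \<and> card VZ \<le> r}"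
  then show "n \<le> b" by (elim CollectE exE conjE) (simp add: assms)
qed

text \<open>The map of realisations induced by a vertex map \<open>g\<close> that is injective on
  \<open>V\<close>. Injectivity lets each target coordinate be read off from a single source
  coordinate, which makes continuity immediate.\<close>

definition push :: "'a set \<Rightarrow> ('a \<Rightarrow> 'b) \<Rightarrow> ('a \<Rightarrow> real) \<Rightarrow> 'b \<Rightarrow> real" where
  "push V g f = (\<lambda>w. if w \<in> g ` V then f (inv_into V g w) else 0)"

lemma continuous_on_push: "continuous_on A (push V g)"
proof (rule continuous_on_coordinatewise_then_product)
  fix w
  show "continuous_on A (\<lambda>f. push V g f w)"
    unfolding push_def by (cases "w \<in> g ` V") (simp_all add: continuous_on_coordinate)
qed

lemma push_closed_simplex:
  assumes Z: "is_complex VZ SZ" and X: "is_complex VX SX"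
    and g: "inj_on g VZ" "\<And>\<sigma>. \<sigma> \<in> SZ \<Longrightarrow> g ` \<sigma> \<in> SX"
    and \<sigma>: "\<sigma> \<in> SZ" and f: "f \<in> closed_simplex VZ SZ \<sigma>"
  shows "push VZ g f \<in> closed_simplex VX SX (g ` \<sigma>)"
proof -
  have sub: "\<sigma> \<subseteq> VZ" using Z \<sigma> by (auto simp: is_complex_def)
  note D = closed_simplexD[OF Z \<sigma> f]
  have "push VZ g f w = 0" if w: "w \<notin> g ` \<sigma>" for w
  proof (cases "w \<in> g ` VZ")
    case True
    then have "inv_into VZ g w \<notin> \<sigma>" using w f_inv_into_f[OF True] by (metis imageI)
    then show ?thesis using D(3) by (simp add: push_def)
  qed (simp add: push_def)
  moreover have "sum (push VZ g f) (g ` \<sigma>) = 1"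
  proof -
    have "sum (push VZ g f) (g ` \<sigma>) = (\<Sum>v\<in>\<sigma>. push VZ g f (g v))"
      using g(1) sub by (intro sum.reindex_cong[of g]) (auto intro: inj_on_subset)
    also have "\<dots> = sum f \<sigma>"
    proof (rule sum.cong)
      fix v assume "v \<in> \<sigma>"
      then show "push VZ g f (g v) = f v" using g(1) subsetD[OF sub] by (simp add: push_def)
    qed simp
    finally show ?thesis using D(4) by simp
  qed
  moreover have "0 \<le> push VZ g f w \<and> push VZ g f w \<le> 1" for w using D(1,2) by (simp add: push_def)
  ultimately show ?thesis
    unfolding closed_simplex_eq[OF X g(2)[OF \<sigma>]] by blast
qed

text \<open>A simplex lies in the adjacency ball of radius 1 about any of its vertices.\<close>

lemma bounded_degree_card_simplex:
  assumes S: "is_complex V S"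
    and D: "\<And>s. s \<in> V \<Longrightarrow> finite {t. t \<noteq> s \<and> {s,t} \<in> S} \<and> card {t. t \<noteq> s \<and> {s,t} \<in> S} \<le> D"
    and U: "U \<in> S"
  shows "card U \<le> Suc D"
proof (cases "U = {}")
  case False
  then obtain v where v: "v \<in> U" by blast
  then have "v \<in> V" using S U by (auto simp: is_complex_def)
  then have B: "finite (adj S `` {v})" "card (adj S `` {v}) \<le> Suc D"
    using card_adj_ball[OF S D, of v 1] by simp_all
  have "U \<subseteq> adj S `` {v}" using simplex_adj[OF S U v] by blast
  then have "card U \<le> card (adj S `` {v})" by (rule card_mono[OF B(1)])
  then show ?thesis using B(2) by (rule order_trans)
qed simp

text \<open>Each point of \<open>realis W R\<close> is interior to exactly one simplex, its support.
  If \<open>f \<circ> \<Psi>\<close> hits \<open>z\<close> on \<open>\<sigma>\<close>, then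
  \<open>\<sigma>\<close> is counted under some \<open>\<tau>\<close> with \<open>z\<close> in the
  image of its closed simplex under \<open>f\<close>. At most \<open>sOv W R f\<close> such
  \<open>\<tau>\<close> exist, each accounting for at most \<open>M\<close> simplices
  \<open>\<sigma>\<close>.\<close>

lemma sTO_le_of_map:
  fixes \<Psi> :: "('a \<Rightarrow> real) \<Rightarrow> ('b \<Rightarrow> real)"
  assumes W: "is_complex W R" "finite W"
    and \<Psi>: "continuous_on (realis VZ SZ) \<Psi>" "\<Psi> ` realis VZ SZ \<subseteq> realis W R"
    and M: "\<And>\<tau>. \<tau> \<in> R \<Longrightarrow> finite {\<sigma>\<in>SZ. \<exists>x\<in>closed_simplex VZ SZ \<sigma>. supp (\<Psi> x) = \<tau>} \<and>
        card {\<sigma>\<in>SZ. \<exists>x\<in>closed_simplex VZ SZ \<sigma>. supp (\<Psi> x) = \<tau>} \<le> M"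
  shows "sTO TYPE('q::finite) VZ SZ \<le> M * sTO TYPE('q) W R"
proof -
  obtain f :: "('b \<Rightarrow> real) \<Rightarrow> real^'q" where f: "continuous_on (realis W R) f" "sOv W R f = sTO TYPE('q) W R"
    by (rule sTO_attained)
  have finR: "finite R" using W by (rule complex_finite)
  have "continuous_on (realis VZ SZ) (f \<circ> \<Psi>)"
    using \<Psi> f(1) continuous_on_subset by (intro continuous_on_compose) blast+
  then have "sTO TYPE('q) VZ SZ \<le> sOv VZ SZ (f \<circ> \<Psi>)" by (rule sTO_le)
  also have "\<dots> \<le> M * sOv W R f"
  proof (rule sOv_least)
    fix z
    let ?C = "\<lambda>\<tau>. {\<sigma>\<in>SZ. \<exists>x\<in>closed_simplex VZ SZ \<sigma>. supp (\<Psi> x) = \<tau>}"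
    let ?T = "{\<tau>\<in>R. z \<in> f ` closed_simplex W R \<tau>}"
    have finT: "finite ?T" using finR by simp
    have "{\<sigma>\<in>SZ. z \<in> (f \<circ> \<Psi>) ` closed_simplex VZ SZ \<sigma>} \<subseteq> (\<Union>\<tau>\<in>?T. ?C \<tau>)"
    proof
      fix \<sigma> assume "\<sigma> \<in> {\<sigma>\<in>SZ. z \<in> (f \<circ> \<Psi>) ` closed_simplex VZ SZ \<sigma>}"
      then obtain x where x: "\<sigma> \<in> SZ" "x \<in> closed_simplex VZ SZ \<sigma>" "z = f (\<Psi> x)" by auto
      then have r: "\<Psi> x \<in> realis W R" using \<Psi>(2) by (auto simp: closed_simplex_def)
      then have "supp (\<Psi> x) \<in> R" "\<Psi> x \<in> closed_simplex W R (supp (\<Psi> x))"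
        by (auto simp: realis_def closed_simplex_def)
      then have "supp (\<Psi> x) \<in> ?T" using x(3) by blast
      moreover have "\<sigma> \<in> ?C (supp (\<Psi> x))" using x by blast
      ultimately show "\<sigma> \<in> (\<Union>\<tau>\<in>?T. ?C \<tau>)" by blast
    qed
    then have "card {\<sigma>\<in>SZ. z \<in> (f \<circ> \<Psi>) ` closed_simplex VZ SZ \<sigma>} \<le> card (\<Union>\<tau>\<in>?T. ?C \<tau>)"
      using finT M by (intro card_mono finite_UN_I) auto
    also have "\<dots> \<le> (\<Sum>\<tau>\<in>?T. card (?C \<tau>))" using finT by (rule card_UN_le)
    also have "\<dots> \<le> (\<Sum>\<tau>\<in>?T. M)" using M by (intro sum_mono) auto
    also have "\<dots> = M * card ?T" by simp
    also have "\<dots> \<le> M * sOv W R f" using card_le_sOv[OF finR] by (intro mult_le_mono2)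
    finally show "card {\<sigma>\<in>SZ. z \<in> (f \<circ> \<Psi>) ` closed_simplex VZ SZ \<sigma>} \<le> M * sOv W R f" .
  qed
  finally show ?thesis using f(2) by simp
qed

theorem theorem1p2:
  fixes VX :: "'a set" and SX :: "'a set set" and VY :: "'b set" and SY :: "'b set set"
    and d :: nat and \<phi> :: "'a \<Rightarrow> 'b"
  assumes "bounded_degree VX SX" and "bounded_degree VY SY"
    and "has_dim SX d"
    and "\<forall>k. 1 \<le> k \<and> k \<le> d \<longrightarrow> unif_connected VY SY k"
    and "regular_map VX SX VY SY \<phi>"
  shows "lesssim (sTO_X (TYPE('q::finite)) VX SX) (sTO_X (TYPE('q)) VY SY)"
proof -
  have X: "is_complex VX SX" and Y: "is_complex VY SY"
    using assms(1,2) by (simp_all add: bounded_degree_def)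
  have \<phi>: "\<phi> ` VX \<subseteq> VY" using assms(5) by (simp add: regular_map_def)
  obtain P :: nat where P: "\<And>y. finite {x\<in>VX. \<phi> x = y} \<and> card {x\<in>VX. \<phi> x = y} \<le> P"
    using assms(5) unfolding regular_map_def by blast
  obtain D where D: "\<And>s. s \<in> VY \<Longrightarrow> finite {t. t \<noteq> s \<and> {s,t} \<in> SY} \<and> card {t. t \<noteq> s \<and> {s,t} \<in> SY} \<le> D"
    using assms(2) unfolding bounded_degree_def by blast
  obtain L where L: "\<And>v w. (v, w) \<in> adj SX \<Longrightarrow> (\<phi> v, \<phi> w) \<in> adj SY ^^ L"
    using regular_map_adj[OF X Y assms(5)] by blast
  have edge: "cdist VY SY (vertex_pt (\<phi> v)) (vertex_pt (\<phi> w)) \<le> ereal (2 * real L)"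
    if "(v, w) \<in> adj SX" for v w
    using cdist_vertex_pt_le[OF Y _ L[OF that]] adj_in_vertices[OF X that] \<phi> by blast
  obtain \<Phi> T where \<Phi>v: "\<And>v. v \<in> VX \<Longrightarrow> \<Phi> (vertex_pt v) = vertex_pt (\<phi> v)"
    and \<Phi>: "\<And>\<sigma>. \<sigma> \<in> SX \<Longrightarrow> continuous_on (closed_simplex VX SX \<sigma>) \<Phi> \<and>
       \<Phi> ` closed_simplex VX SX \<sigma> \<subseteq> realis VY SY \<and> diam_le VY SY (\<Phi> ` closed_simplex VX SX \<sigma>) T"
  proof -
    have "\<And>\<sigma>. \<sigma> \<in> SX \<Longrightarrow> card \<sigma> \<le> Suc d" using assms(3) by (simp add: has_dim_def)
    then show thesis
      using skeleton_extension[OF X Y assms(4) \<phi> edge order_refl] that by blast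
  qed
  \<comment> \<open>This is the radius required by \<open>supp_in_adj_ball\<close>, with
    \<open>Suc D\<close> bounding the size of simplices of \<open>Y\<close>; \<open>T + 1\<close>
    turns the non-strict diameter bound \<open>T\<close> into a strict one.\<close>
  obtain N :: nat where N: "real N > 2 + real (Suc D) * (T + 1)"
    using reals_Archimedean2 by blast
  have near: "supp (\<Phi> x) \<subseteq> (adj SY ^^ N) `` {\<phi> v}"
    if \<sigma>: "\<sigma> \<in> SX" and v: "v \<in> \<sigma>" and x: "x \<in> closed_simplex VX SX \<sigma>" for \<sigma> v x
  proof
    fix w assume w: "w \<in> supp (\<Phi> x)"
    have "v \<in> VX" using X \<sigma> v by (auto simp: is_complex_def)
    then have pt: "vertex_pt (\<phi> v) \<in> \<Phi> ` closed_simplex VX SX \<sigma>"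
      using \<Phi>v vertex_pt_closed_simplex[OF X \<sigma> v] by force
    then have "cdist VY SY (vertex_pt (\<phi> v)) (\<Phi> x) \<le> ereal T"
      using \<Phi>[OF \<sigma>] x unfolding diam_le_def by blast
    also have "\<dots> < ereal (T + 1)" by simp
    finally have d: "cdist VY SY (vertex_pt (\<phi> v)) (\<Phi> x) < ereal (T + 1)" .
    have "(\<phi> v, w) \<in> adj SY ^^ N"
    proof (rule supp_in_adj_ball[OF Y _ _ _ d _ w N])
      show "card U \<le> Suc D" if "U \<in> SY" for U
        using bounded_degree_card_simplex[OF Y D that] .
      show "vertex_pt (\<phi> v) \<in> realis VY SY" "\<Phi> x \<in> realis VY SY" using \<Phi>[OF \<sigma>] pt x by blast+
    qed simp
    then show "w \<in> (adj SY ^^ N) `` {\<phi> v}" by simp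
  qed
  have ball: "finite ((adj SY ^^ N) `` {v}) \<and> card ((adj SY ^^ N) `` {v}) \<le> Suc D ^ N
      \<and> (adj SY ^^ N) `` {v} \<subseteq> VY" if "v \<in> VY" for v
    by (rule card_adj_ball[OF Y D that])
  \<comment> \<open>\<open>Q\<close> bounds the number of vertices sent into one ball: fibres of
    size at most \<open>P\<close> over at most \<open>Suc D ^ N\<close> points. \<open>C\<close>
    must dominate both \<open>2 ^ Q\<close>, the number of simplices on such vertices, and
    \<open>Suc D ^ N\<close>, the number of vertices of \<open>W\<close> per vertex of
    \<open>Z\<close>.\<close>
  define Q where "Q = P * Suc D ^ N"
  define C where "C = max (2 ^ Q) (Suc D ^ N)"
  have "sTO_X TYPE('q) VX SX r \<le> C * sTO_X TYPE('q) VY SY (C * r)" for r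
  proof (rule sTO_X_least)
    fix VZ :: "'a set" and SZ
    assume Z: "is_complex VZ SZ" "finite VZ" and le: "complex_le VZ SZ VX SX" and r: "card VZ \<le> r"
    obtain g where g: "inj_on g VZ" "g ` VZ \<subseteq> VX" "\<And>\<sigma>. \<sigma> \<in> SZ \<Longrightarrow> g ` \<sigma> \<in> SX"
      using le unfolding complex_le_def by blast
    have gV: "\<phi> (g v) \<in> VY" if "v \<in> VZ" for v using g(2) \<phi> that by blast
    define \<Psi> where "\<Psi> = \<Phi> \<circ> push VZ g"
    define W where "W = (\<Union>v\<in>VZ. (adj SY ^^ N) `` {\<phi> (g v)})"
    \<comment> \<open>The full subcomplex on \<open>W\<close>, so that a point of the realisation of
      \<open>Y\<close> belongs to it as soon as its support lies in \<open>W\<close>.\<close>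
    define R where "R = {U \<in> SY. U \<subseteq> W}"
    have push: "push VZ g x \<in> closed_simplex VX SX (g ` \<sigma>)"
      if "\<sigma> \<in> SZ" "x \<in> closed_simplex VZ SZ \<sigma>" for \<sigma> x
      using push_closed_simplex[OF Z(1) X g(1) _ that] g(3) by simp
    have near': "supp (\<Psi> x) \<subseteq> (adj SY ^^ N) `` {\<phi> (g v)}"
      if "\<sigma> \<in> SZ" "v \<in> \<sigma>" "x \<in> closed_simplex VZ SZ \<sigma>" for \<sigma> v x
      using near[OF g(3)[OF that(1)] imageI[OF that(2)] push[OF that(1,3)]] by (simp add: \<Psi>_def)
    have finW: "finite W" unfolding W_def using Z(2) ball[OF gV] by blast
    have WY: "W \<subseteq> VY" unfolding W_def using ball[OF gV] by blast
    have cardW: "card W \<le> C * r"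
    proof -
      have "card W \<le> (\<Sum>v\<in>VZ. card ((adj SY ^^ N) `` {\<phi> (g v)}))"
        unfolding W_def using Z(2) by (rule card_UN_le)
      also have "\<dots> \<le> (\<Sum>v\<in>VZ. Suc D ^ N)" using ball[OF gV] by (intro sum_mono) blast
      also have "\<dots> \<le> C * r" using r by (simp add: C_def mult.commute mult_le_mono)
      finally show ?thesis .
    qed
    have R: "is_complex W R"
      using Y WY unfolding is_complex_def R_def by (auto 0 3)
    have RY: "complex_le W R VY SY"
      unfolding complex_le_def using WY by (intro exI[of _ id]) (auto simp: R_def)
    have "sTO TYPE('q) VZ SZ \<le> 2 ^ Q * sTO TYPE('q) W R"
    proof (rule sTO_le_of_map[OF R finW, where \<Psi> = \<Psi>])
      have cont: "continuous_on (closed_simplex VZ SZ \<sigma>) \<Psi>" if "\<sigma> \<in> SZ" for \<sigma>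
        unfolding \<Psi>_def
      proof (rule continuous_on_compose[OF continuous_on_push])
        show "continuous_on (push VZ g ` closed_simplex VZ SZ \<sigma>) \<Phi>"
          using \<Phi>[OF g(3)[OF that]] push[OF that] by (blast intro: continuous_on_subset)
      qed
      \<comment> \<open>Continuity on single simplices becomes global here, because \<open>Z\<close>
        is a finite union of closed simplices.\<close>
      show "continuous_on (realis VZ SZ) \<Psi>"
        unfolding realis_eq_Union
        using complex_finite[OF Z] closed_closed_simplex[OF Z(1)] cont by (rule continuous_on_closed_Union)
      show "\<Psi> ` realis VZ SZ \<subseteq> realis W R"
      proof (rule image_subsetI)
        fix x assume "x \<in> realis VZ SZ"
        then obtain \<sigma> where \<sigma>: "\<sigma> \<in> SZ" "x \<in> closed_simplex VZ SZ \<sigma>" unfolding realis_eq_Union by blast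
        obtain v where v: "v \<in> \<sigma>" using \<sigma>(2) realis_supp_nonempty[of x VZ SZ]
          by (auto simp: closed_simplex_def)
        then have "v \<in> VZ" using Z(1) \<sigma>(1) by (auto simp: is_complex_def)
        then have "supp (\<Psi> x) \<subseteq> W" using near'[OF \<sigma>(1) v \<sigma>(2)] unfolding W_def by blast
        moreover have "\<Psi> x \<in> realis VY SY"
          using \<Phi>[OF g(3)[OF \<sigma>(1)]] push[OF \<sigma>] unfolding \<Psi>_def by auto
        ultimately show "\<Psi> x \<in> realis W R" by (simp add: realis_def R_def)
      qed
      fix \<tau> assume "\<tau> \<in> R"
      let ?C = "{\<sigma>\<in>SZ. \<exists>x\<in>closed_simplex VZ SZ \<sigma>. supp (\<Psi> x) = \<tau>}"
      show "finite ?C \<and> card ?C \<le> 2 ^ Q"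
      \<comment> \<open>The empty set may belong to \<open>R\<close> but is never the support of a
        point; any other \<open>\<tau>\<close> has a vertex \<open>u\<close> at which a ball can be
        centred.\<close>
      proof (cases "\<tau> = {}")
        case True
        have "supp (\<Psi> x) \<noteq> {}" if "\<sigma> \<in> SZ" "x \<in> closed_simplex VZ SZ \<sigma>" for \<sigma> x
          using \<Phi>[OF g(3)[OF that(1)]] push[OF that] realis_supp_nonempty[of "\<Psi> x" VY SY]
          unfolding \<Psi>_def by auto
        then have "?C = {}" using True by blast
        then show ?thesis by (metis card.empty finite.emptyI le0)
      next
        case False
        then obtain u where u: "u \<in> \<tau>" by blast
        then have "u \<in> VY" using \<open>\<tau> \<in> R\<close> WY by (auto simp: R_def)
        note Bu = ball[OF this]
        \<comment> \<open>If some point of \<open>\<sigma>\<close> has an image with support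
          \<open>\<tau>\<close>, then \<open>u\<close> is within \<open>N\<close> steps of the image
          of every vertex of \<open>\<sigma>\<close>. By symmetry of adjacency these vertices all
          lie in \<open>K\<close>, so \<open>\<sigma>\<close> is one of its subsets.\<close>
        define K where "K = {v \<in> VZ. \<phi> (g v) \<in> (adj SY ^^ N) `` {u}}"
        have "?C \<subseteq> Pow K"
        proof
          fix \<sigma> assume "\<sigma> \<in> ?C"
          then obtain x where x: "\<sigma> \<in> SZ" "x \<in> closed_simplex VZ SZ \<sigma>" "supp (\<Psi> x) = \<tau>" by blast
          have "v \<in> K" if v: "v \<in> \<sigma>" for v
          proof -
            have "v \<in> VZ" using Z(1) x(1) v by (auto simp: is_complex_def)
            moreover have "(\<phi> (g v), u) \<in> adj SY ^^ N" using near'[OF x(1) v x(2)] u x(3) by blast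
            then have "(u, \<phi> (g v)) \<in> adj SY ^^ N" by (rule adj_relpow_sym)
            ultimately show ?thesis by (simp add: K_def)
          qed
          then show "\<sigma> \<in> Pow K" by blast
        qed
        moreover have finK: "finite K" using Z(2) by (simp add: K_def)
        moreover have "card K \<le> Q"
        proof -
          let ?F = "\<Union>y\<in>(adj SY ^^ N) `` {u}. {x\<in>VX. \<phi> x = y}"
          have "card K = card (g ` K)"
            using g(1) by (intro card_image[symmetric]) (auto simp: K_def intro: inj_on_subset)
          also have "\<dots> \<le> card ?F"
            using Bu P g(2) by (intro card_mono finite_UN_I) (auto simp: K_def)
          also have "\<dots> \<le> (\<Sum>y\<in>(adj SY ^^ N) `` {u}. card {x\<in>VX. \<phi> x = y})"
            using Bu by (intro card_UN_le) blast
          also have "\<dots> \<le> (\<Sum>y\<in>(adj SY ^^ N) `` {u}. P)" using P by (intro sum_mono) blast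
          also have "\<dots> \<le> Q" using Bu by (simp add: Q_def mult.commute)
          finally show ?thesis .
        qed
        ultimately show ?thesis
        proof (intro conjI)
          assume *: "?C \<subseteq> Pow K" "finite K" "card K \<le> Q"
          show "finite ?C" using *(1,2) by (simp add: finite_subset)
          have "card ?C \<le> card (Pow K)" using *(1,2) by (intro card_mono) auto
          also have "\<dots> \<le> 2 ^ Q" using *(2,3) by (simp add: card_Pow)
          finally show "card ?C \<le> 2 ^ Q" .
        qed
      qed
    qed
    also have "\<dots> \<le> C * sTO_X TYPE('q) VY SY (C * r)"
      by (intro mult_le_mono sTO_le_sTO_X R finW RY cardW) (simp add: C_def)
    finally show "sTO TYPE('q) VZ SZ \<le> C * sTO_X TYPE('q) VY SY (C * r)" .
  qed
  then show ?thesis unfolding lesssim_def by (intro exI[of _ C] allI trans_le_add1)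
qed

end
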